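(* There is an algorithm that, given a strongly connected weighted digraph $G=(V,E,w)$ with $m$ edges, unweighted diameter $d$ and weights in $[-w_{\max},w_{\max}]$, a normalized flow $P\in\Delta_E$ with $\|P\mathbf{1}-P^T\mathbf{1}\|_1\le 1/d$, and an accuracy $\varepsilon>0$, takes $O(m d w_{\max}/\varepsilon)$ time to output a cycle $\sigma$ in $G$ satisfying $$\bar w(\sigma)\le \langle P,W\rangle+\frac{\varepsilon}{4}+4w_{\max} d\,\|P\mathbf{1}-P^T\mathbf{1}\|_1.$$ In particular, if $\|P\mathbf{1}-P^T\mathbf{1}\|_1\le \varepsilon/(16 w_{\max} d)$, then $\bar w(\sigma)\le\langle P,W\rangle+\varepsilon/2$.
   Context: Vertices are identified with $[n]$. $W$ is the $n\times n$ matrix with $W_{ij}=w(i,j)$ for $(i,j)\in E$ (and $\infty$ otherwise), and $\langle P,W\rangle=\sum_{(i,j)\in E}P_{ij}W_{ij}$. $\Delta_E=\{P\in\mathbb{R}_{\ge0}^{n\times n}:\sum_{ij}P_{ij}=1,\ \mathrm{supp}(P)\subseteq E\}$ is the set of normalized flows on $G$; $\mathbf{1}$ is the all-ones vector, so $\|P\mathbf{1}-P^T\mathbf{1}\|_1$ is the total netflow imbalance. For a directed cycle $\sigma$, $\bar w(\sigma)=\frac1{|\sigma|}\sum_{e\in\sigma}w(e)$. The unweighted diameter $d$ is the maximum over ordered vertex pairs of the number of edges on a shortest directed path.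
   Formalization: The time bound O(m d w_max/ε) is proved for ε ≤ d·w_max; for larger ε it is replaced by O(m), since the stated bound then tends to 0 (or is 0 if d = 0 or w_max = 0) and fails, e.g. on a directed n-cycle, whose output alone takes n steps. The error bounds hold for every ε > 0. *)

theory Defs
  imports Complex_Main "Graph_Theory.Graph_Theory"
begin

section \<open>Digraphs, flows and imbalance\<close>

definition hop_distance :: "nat pair_pre_digraph \<Rightarrow> nat \<Rightarrow> nat \<Rightarrow> nat" where
  "hop_distance G u v =
     (LEAST k. \<exists>p. pre_digraph.apath (with_proj G) u p v \<and> length p = k)"

definition diameter :: "nat pair_pre_digraph \<Rightarrow> nat" where
  "diameter G = Max {hop_distance G u v |u v. u \<in> pverts G \<and> v \<in> pverts G}"

definition mean_weight :: "(nat \<times> nat \<Rightarrow> real) \<Rightarrow> (nat \<times> nat) list \<Rightarrow> real" where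
  "mean_weight w \<sigma> = (\<Sum>e\<leftarrow>\<sigma>. w e) / real (length \<sigma>)"

text \<open>
  An \<open>n \<times> n\<close> matrix is a function of two indices, of which only the entries with both indices in
  the vertex set are meaningful. The weight matrix is only used on the edges, so it is represented
  by the weight function itself.
\<close>

definition normalized_flows :: "nat pair_pre_digraph \<Rightarrow> (nat \<Rightarrow> nat \<Rightarrow> real) set" where
  "normalized_flows G =
     {P. (\<forall>i\<in>pverts G. \<forall>j\<in>pverts G. 0 \<le> P i j) \<and>
         (\<Sum>i\<in>pverts G. \<Sum>j\<in>pverts G. P i j) = 1 \<and>
         (\<forall>i\<in>pverts G. \<forall>j\<in>pverts G. P i j \<noteq> 0 \<longrightarrow> (i, j) \<in> parcs G)}"

definition flow_cost ::
  "nat pair_pre_digraph \<Rightarrow> (nat \<Rightarrow> nat \<Rightarrow> real) \<Rightarrow> (nat \<times> nat \<Rightarrow> real) \<Rightarrow> real" where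
  "flow_cost G P w = (\<Sum>(i, j)\<in>parcs G. P i j * w (i, j))"

text \<open>
  A strongly connected digraph has diameter \<open>0\<close> only if it has a single vertex. Its imbalance is
  then \<open>0\<close>, so bounding the imbalance by \<open>1 / real d\<close> is harmless although this is \<open>0\<close> for \<open>d = 0\<close>.
\<close>

definition imbalance :: "nat pair_pre_digraph \<Rightarrow> (nat \<Rightarrow> nat \<Rightarrow> real) \<Rightarrow> real" where
  "imbalance G P =
     (\<Sum>i\<in>pverts G. \<bar>(\<Sum>j\<in>pverts G. P i j) - (\<Sum>j\<in>pverts G. P j i)\<bar>)"


section \<open>Algorithms: programs of a real random access machine\<close>

text \<open>
  An algorithm is a program of the structured language below, executed with unit cost. Natural
  numbers serve as indices and counters (with addition and truncated subtraction only). Reals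
  support exact field arithmetic and comparison, but there is no rounding and no
  conversion from reals to naturals. Real constants in programs are rational.
\<close>

type_synonym vname = string

record state =
  nat_reg  :: "vname \<Rightarrow> nat"
  real_reg :: "vname \<Rightarrow> real"
  nat_mem  :: "vname \<Rightarrow> nat \<Rightarrow> nat"
  real_mem :: "vname \<Rightarrow> nat \<Rightarrow> real"

datatype nexp =
    NConst nat
  | NReg vname
  | NRead vname nexp
  | NPlus nexp nexp
  | NMinus nexp nexp

datatype rexp =
    RConst rat
  | RReg vname
  | RRead vname nexp
  | RPlus rexp rexp
  | RMinus rexp rexp
  | RTimes rexp rexp
  | RDivide rexp rexp

datatype test =
    NLess nexp nexp
  | RLess rexp rexp
  | TNot test
  | TAnd test test

fun nval :: "nexp \<Rightarrow> state \<Rightarrow> nat" where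
  "nval (NConst k) s = k"
| "nval (NReg x) s = nat_reg s x"
| "nval (NRead a i) s = nat_mem s a (nval i s)"
| "nval (NPlus e f) s = nval e s + nval f s"
| "nval (NMinus e f) s = nval e s - nval f s"

fun rval :: "rexp \<Rightarrow> state \<Rightarrow> real" where
  "rval (RConst q) s = of_rat q"
| "rval (RReg x) s = real_reg s x"
| "rval (RRead a i) s = real_mem s a (nval i s)"
| "rval (RPlus e f) s = rval e s + rval f s"
| "rval (RMinus e f) s = rval e s - rval f s"
| "rval (RTimes e f) s = rval e s * rval f s"
| "rval (RDivide e f) s = rval e s / rval f s"

fun tval :: "test \<Rightarrow> state \<Rightarrow> bool" where
  "tval (NLess e f) s \<longleftrightarrow> nval e s < nval f s"
| "tval (RLess e f) s \<longleftrightarrow> rval e s < rval f s"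
| "tval (TNot b) s \<longleftrightarrow> \<not> tval b s"
| "tval (TAnd b c) s \<longleftrightarrow> tval b s \<and> tval c s"

datatype com =
    Skip
  | NAssign vname nexp
  | RAssign vname rexp
  | NWrite vname nexp nexp
  | RWrite vname nexp rexp
  | Seq com com
  | Cond test com com
  | While test com

text \<open>
  \<open>exec c s t s'\<close>: started in state \<open>s\<close>, the program \<open>c\<close> terminates in state \<open>s'\<close> after \<open>t\<close> time
  units. Each elementary command and each evaluation of a test costs one unit. The expressions in
  a fixed program have bounded size, so charging every arithmetic operation and memory access
  separately would change the time by at most a factor depending only on the program.

  A bound \<open>O(m d wmax / \<epsilon>)\<close> on the time is only meaningful for \<open>\<epsilon> \<le> d wmax\<close>: for larger \<open>\<epsilon>\<close> it drops
  below the size of the input (and possibly of the output), and is replaced by \<open>O(m)\<close>.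
\<close>

inductive exec :: "com \<Rightarrow> state \<Rightarrow> nat \<Rightarrow> state \<Rightarrow> bool" where
  Skip: "exec Skip s 1 s"
| NAssign: "exec (NAssign x e) s 1 (s\<lparr>nat_reg := (nat_reg s)(x := nval e s)\<rparr>)"
| RAssign: "exec (RAssign x e) s 1 (s\<lparr>real_reg := (real_reg s)(x := rval e s)\<rparr>)"
| NWrite: "exec (NWrite a i e) s 1
    (s\<lparr>nat_mem := (nat_mem s)(a := (nat_mem s a)(nval i s := nval e s))\<rparr>)"
| RWrite: "exec (RWrite a i e) s 1
    (s\<lparr>real_mem := (real_mem s)(a := (real_mem s a)(nval i s := rval e s))\<rparr>)"
| Seq: "exec c1 s1 t1 s2 \<Longrightarrow> exec c2 s2 t2 s3 \<Longrightarrow> exec (Seq c1 c2) s1 (t1 + t2) s3"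
| CondTrue: "tval b s \<Longrightarrow> exec c1 s t s' \<Longrightarrow> exec (Cond b c1 c2) s (1 + t) s'"
| CondFalse: "\<not> tval b s \<Longrightarrow> exec c2 s t s' \<Longrightarrow> exec (Cond b c1 c2) s (1 + t) s'"
| WhileFalse: "\<not> tval b s \<Longrightarrow> exec (While b c) s 1 s"
| WhileTrue: "tval b s1 \<Longrightarrow> exec c s1 t1 s2 \<Longrightarrow> exec (While b c) s2 t2 s3 \<Longrightarrow>
    exec (While b c) s1 (1 + t1 + t2) s3"

text \<open>
  The input is an edge list in arbitrary order, with the weight and the flow value of each edge,
  together with the accuracy. All other registers and memory cells have arbitrary initial contents.
  Neither the diameter nor the weight bound is part of the input.
\<close>

definition input_loaded ::
  "nat \<Rightarrow> (nat \<times> nat) list \<Rightarrow> (nat \<times> nat \<Rightarrow> real) \<Rightarrow> (nat \<Rightarrow> nat \<Rightarrow> real) \<Rightarrow> real \<Rightarrow> state \<Rightarrow> bool"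
where
  "input_loaded n es w P \<epsilon> s \<longleftrightarrow>
     nat_reg s ''n'' = n \<and> nat_reg s ''m'' = length es \<and> real_reg s ''eps'' = \<epsilon> \<and>
     (\<forall>k<length es.
        nat_mem s ''tail'' k = fst (es ! k) \<and>
        nat_mem s ''head'' k = snd (es ! k) \<and>
        real_mem s ''w'' k = w (es ! k) \<and>
        real_mem s ''P'' k = P (fst (es ! k)) (snd (es ! k)))"

definition output_cycle :: "state \<Rightarrow> (nat \<times> nat) list" where
  "output_cycle s =
     map (\<lambda>k. (nat_mem s ''out_tail'' k, nat_mem s ''out_head'' k)) [0..<nat_reg s ''out_len'']"

end

theory Submission
  imports Defs
begin

text \<open>
  Let \<open>D k v\<close> be the minimum weight of a walk with exactly \<open>k\<close> edges that ends in \<open>v\<close>. Weighting the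
  inequalities \<open>D (k + 1) v \<le> D k u + w (u, v)\<close> by the flow \<open>P u v\<close> and summing over the edges and over
  \<open>k < K\<close> telescopes up to the imbalance \<open>\<delta>\<close> of \<open>P\<close>. As \<open>D k\<close> varies by at most \<open>2 d wmax\<close> over the
  vertices, \<open>min D K \<le> K (\<langle>P, W\<rangle> + 2 d wmax \<delta>)\<close>. In particular the algorithm can ignore the flow.

  An optimal \<open>K\<close>-edge walk is closed by a shortest path from its end to its start, of length \<open>l \<le> d\<close>.
  This adds at most \<open>2 l wmax / K\<close> to the mean weight, which is at most \<open>\<epsilon> / 4\<close> as soon as
  \<open>8 l wmax \<le> \<epsilon> K\<close>. The program computes \<open>D\<close> layer by layer and, knowing neither \<open>d\<close> nor \<open>wmax\<close>, finds \<open>l\<close>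
  by a breadth-first search after each layer and stops when this test succeeds, with the maximum of
  \<open>|w e|\<close> in place of \<open>wmax\<close>. Hence there are at most \<open>8 d wmax / \<epsilon> + 2\<close> rounds of \<open>O(m)\<close> steps. Erasing
  the loops of the closed walk one by one yields a simple cycle whose mean is at most that of the walk.
\<close>

section \<open>Weakest preconditions with running time\<close>

notation Seq (infixr ";;" 60)

text \<open>The postcondition also receives the running time, so one judgement covers termination,
  the result and the time bound.\<close>

definition wp :: "com \<Rightarrow> (nat \<Rightarrow> state \<Rightarrow> bool) \<Rightarrow> state \<Rightarrow> bool" where
  "wp c Q s \<longleftrightarrow> (\<exists>t s'. exec c s t s' \<and> Q t s')"

inductive_cases exec_SkipE: "exec Skip s t s'"
inductive_cases exec_NAssignE: "exec (NAssign x e) s t s'"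
inductive_cases exec_RAssignE: "exec (RAssign x e) s t s'"
inductive_cases exec_NWriteE: "exec (NWrite a i e) s t s'"
inductive_cases exec_RWriteE: "exec (RWrite a i e) s t s'"
inductive_cases exec_SeqE: "exec (c1 ;; c2) s t s'"
inductive_cases exec_CondE: "exec (Cond b c1 c2) s t s'"

lemma wp_simps [simp]:
  "wp Skip Q s = Q 1 s"
  "wp (NAssign x e) Q s = Q 1 (s\<lparr>nat_reg := (nat_reg s)(x := nval e s)\<rparr>)"
  "wp (RAssign y r) Q s = Q 1 (s\<lparr>real_reg := (real_reg s)(y := rval r s)\<rparr>)"
  "wp (NWrite a i e) Q s =
     Q 1 (s\<lparr>nat_mem := (nat_mem s)(a := (nat_mem s a)(nval i s := nval e s))\<rparr>)"
  "wp (RWrite a i r) Q s =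
     Q 1 (s\<lparr>real_mem := (real_mem s)(a := (real_mem s a)(nval i s := rval r s))\<rparr>)"
  "wp (Cond b c1 c2) Q s = wp (if tval b s then c1 else c2) (\<lambda>t. Q (1 + t)) s"
  by (auto simp: wp_def intro: exec.intros[simplified]
      elim!: exec_SkipE exec_NAssignE exec_RAssignE exec_NWriteE exec_RWriteE exec_CondE)

lemma wp_Seq [simp]: "wp (c1 ;; c2) Q s = wp c1 (\<lambda>t s'. wp c2 (\<lambda>t'. Q (t + t')) s') s"
  unfolding wp_def by (blast elim: exec_SeqE intro: exec.Seq)

text \<open>\<open>\<Phi>\<close> bounds the remaining time, so it serves as the termination measure as well.\<close>

lemma wp_while:
  assumes "I s"
    and step: "\<And>s. I s \<Longrightarrow> tval b s \<Longrightarrow> wp c (\<lambda>t s'. I s' \<and> t + 1 + \<Phi> s' \<le> \<Phi> s) s"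
    and post: "\<And>t s'. I s' \<Longrightarrow> \<not> tval b s' \<Longrightarrow> t \<le> \<Phi> s + 1 \<Longrightarrow> Q t s'"
  shows "wp (While b c) Q s"
proof -
  have "\<exists>t s'. exec (While b c) s t s' \<and> I s' \<and> \<not> tval b s' \<and> t \<le> \<Phi> s + (1 :: nat)"
    using \<open>I s\<close>
  \<comment> \<open>The cost of the loop test makes \<open>\<Phi>\<close> strictly smaller in each
    iteration.\<close>
  proof (induction "\<Phi> s" arbitrary: s rule: less_induct)
    case less
    show ?case
    proof (cases "tval b s")
      case True
      from step[OF less.prems True] obtain t1 s1 where
        1: "exec c s t1 s1" "I s1" "t1 + 1 + \<Phi> s1 \<le> \<Phi> s"
        unfolding wp_def by blast
      then obtain t2 s2 where
        "exec (While b c) s1 t2 s2" "I s2" "\<not> tval b s2" "t2 \<le> \<Phi> s1 + 1"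
        using less.hyps[of s1] by auto
      with 1 show ?thesis
        using exec.WhileTrue[OF True 1(1)]
        by (intro exI[of _ "1 + t1 + t2"] exI[of _ s2]) auto
    next
      case False
      with less.prems show ?thesis
        by (intro exI[of _ 1] exI[of _ s]) (auto intro: exec.WhileFalse[simplified])
    qed
  qed
  with post show ?thesis unfolding wp_def by blast
qed

section \<open>Frame conditions: what a program leaves unchanged\<close>

primrec nregs :: "com \<Rightarrow> vname set" where
  "nregs Skip = {}"
| "nregs (NAssign x e) = {x}"
| "nregs (RAssign x e) = {}"
| "nregs (NWrite a i e) = {}"
| "nregs (RWrite a i e) = {}"
| "nregs (Seq c1 c2) = nregs c1 \<union> nregs c2"
| "nregs (Cond b c1 c2) = nregs c1 \<union> nregs c2"
| "nregs (While b c) = nregs c"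

primrec rregs :: "com \<Rightarrow> vname set" where
  "rregs Skip = {}"
| "rregs (NAssign x e) = {}"
| "rregs (RAssign x e) = {x}"
| "rregs (NWrite a i e) = {}"
| "rregs (RWrite a i e) = {}"
| "rregs (Seq c1 c2) = rregs c1 \<union> rregs c2"
| "rregs (Cond b c1 c2) = rregs c1 \<union> rregs c2"
| "rregs (While b c) = rregs c"

primrec nmems :: "com \<Rightarrow> vname set" where
  "nmems Skip = {}"
| "nmems (NAssign x e) = {}"
| "nmems (RAssign x e) = {}"
| "nmems (NWrite a i e) = {a}"
| "nmems (RWrite a i e) = {}"
| "nmems (Seq c1 c2) = nmems c1 \<union> nmems c2"
| "nmems (Cond b c1 c2) = nmems c1 \<union> nmems c2"
| "nmems (While b c) = nmems c"

primrec rmems :: "com \<Rightarrow> vname set" where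
  "rmems Skip = {}"
| "rmems (NAssign x e) = {}"
| "rmems (RAssign x e) = {}"
| "rmems (NWrite a i e) = {}"
| "rmems (RWrite a i e) = {a}"
| "rmems (Seq c1 c2) = rmems c1 \<union> rmems c2"
| "rmems (Cond b c1 c2) = rmems c1 \<union> rmems c2"
| "rmems (While b c) = rmems c"

text \<open>Read off the program text, so that facts about untouched variables pass across a
  subprogram without being repeated in its specification.\<close>

definition frame :: "com \<Rightarrow> state \<Rightarrow> state \<Rightarrow> bool" where
  "frame c s s' \<longleftrightarrow>
     (\<forall>x. x \<notin> nregs c \<longrightarrow> nat_reg s' x = nat_reg s x) \<and>
     (\<forall>x. x \<notin> rregs c \<longrightarrow> real_reg s' x = real_reg s x) \<and>
     (\<forall>a. a \<notin> nmems c \<longrightarrow> nat_mem s' a = nat_mem s a) \<and>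
     (\<forall>a. a \<notin> rmems c \<longrightarrow> real_mem s' a = real_mem s a)"

lemma frameD:
  assumes "frame c s s'"
  shows "x \<notin> nregs c \<Longrightarrow> nat_reg s' x = nat_reg s x"
    and "x \<notin> rregs c \<Longrightarrow> real_reg s' x = real_reg s x"
    and "x \<notin> nmems c \<Longrightarrow> nat_mem s' x = nat_mem s x"
    and "x \<notin> rmems c \<Longrightarrow> real_mem s' x = real_mem s x"
  using assms unfolding frame_def by blast+

lemma exec_frame: "exec c s t s' \<Longrightarrow> frame c s s'"
  by (induction rule: exec.induct) (auto simp: frame_def)

lemma wp_conseq:
  assumes "wp c R s" "\<And>t s'. R t s' \<Longrightarrow> frame c s s' \<Longrightarrow> Q t s'"
  shows "wp c Q s"
  using assms exec_frame unfolding wp_def by blast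

definition nat_eq :: "nexp \<Rightarrow> nexp \<Rightarrow> test" where
  "nat_eq e f = TAnd (TNot (NLess e f)) (TNot (NLess f e))"

lemma tval_nat_eq [simp]: "tval (nat_eq e f) s \<longleftrightarrow> nval e s = nval f s"
  by (auto simp: nat_eq_def)

abbreviation incr :: "vname \<Rightarrow> com" where
  "incr x \<equiv> NAssign x (NPlus (NReg x) (NConst 1))"


section \<open>The program\<close>

text \<open>
  Edges are numbered by their position in the input. The adjacency lists are linked: \<open>first\<close> and
  \<open>next\<close> hold an edge number plus one, with \<open>0\<close> as the end marker. The table \<open>D\<close> of minimum weights of
  \<open>k\<close>-edge walks ending in \<open>v\<close> is stored at index \<open>k * n + v\<close> (with \<open>b = k * n\<close> kept in a register,
  as there is no multiplication of naturals), together with the last edge \<open>pred\<close> and the first vertex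
  \<open>start\<close> of such a walk.

  Memory is uninitialised. Instead of clearing it, the programs accept an entry only if it points
  back to the index that it was read from: \<open>pred\<close> is valid in the current round iff it is an already
  scanned edge into \<open>v\<close>, and \<open>pos\<close> is valid iff the queue (or stack) holds the vertex at that position.
\<close>

definition init_vertices :: com where
  "init_vertices =
     NAssign ''v'' (NConst 0) ;;
     While (NLess (NReg ''v'') (NReg ''n''))
      (NWrite ''first'' (NReg ''v'') (NConst 0) ;;
       RWrite ''D'' (NReg ''v'') (RConst 0) ;;
       NWrite ''start'' (NReg ''v'') (NReg ''v'') ;;
       incr ''v'')"

definition init_edges :: com where
  "init_edges =
     NAssign ''e'' (NConst 0) ;;
     RAssign ''wm'' (RConst 0) ;;
     While (NLess (NReg ''e'') (NReg ''m''))
      (NWrite ''next'' (NReg ''e'') (NRead ''first'' (NRead ''tail'' (NReg ''e''))) ;;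
       NWrite ''first'' (NRead ''tail'' (NReg ''e'')) (NPlus (NReg ''e'') (NConst 1)) ;;
       Cond (RLess (RReg ''wm'') (RRead ''w'' (NReg ''e'')))
         (RAssign ''wm'' (RRead ''w'' (NReg ''e''))) Skip ;;
       Cond (RLess (RReg ''wm'') (RMinus (RConst 0) (RRead ''w'' (NReg ''e''))))
         (RAssign ''wm'' (RMinus (RConst 0) (RRead ''w'' (NReg ''e'')))) Skip ;;
       incr ''e'')"

definition relax :: com where
  "relax =
     NAssign ''c'' (NPlus (NReg ''b'') (NReg ''n'')) ;;
     NAssign ''e'' (NConst 0) ;;
     While (NLess (NReg ''e'') (NReg ''m''))
      (NAssign ''v'' (NPlus (NReg ''c'') (NRead ''head'' (NReg ''e''))) ;;
       NAssign ''u'' (NPlus (NReg ''b'') (NRead ''tail'' (NReg ''e''))) ;;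
       RAssign ''r'' (RPlus (RRead ''D'' (NReg ''u'')) (RRead ''w'' (NReg ''e''))) ;;
       Cond
         (TAnd (NLess (NRead ''pred'' (NReg ''v'')) (NReg ''e''))
           (TAnd (nat_eq (NRead ''head'' (NRead ''pred'' (NReg ''v''))) (NRead ''head'' (NReg ''e'')))
             (TNot (RLess (RReg ''r'') (RRead ''D'' (NReg ''v''))))))
         Skip
         (RWrite ''D'' (NReg ''v'') (RReg ''r'') ;;
          NWrite ''pred'' (NReg ''v'') (NReg ''e'') ;;
          NWrite ''start'' (NReg ''v'') (NRead ''start'' (NReg ''u''))) ;;
       incr ''e'')"

definition find_min :: com where
  "find_min =
     NAssign ''z'' (NConst 0) ;;
     NAssign ''v'' (NConst 0) ;;
     While (NLess (NReg ''v'') (NReg ''n''))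
      (Cond (RLess (RRead ''D'' (NPlus (NReg ''c'') (NReg ''v'')))
                   (RRead ''D'' (NPlus (NReg ''c'') (NReg ''z''))))
         (NAssign ''z'' (NReg ''v'')) Skip ;;
       incr ''v'')"

text \<open>Scanning an edge and dequeuing a vertex are turns of one loop rather than of two nested
  loops, so a single potential bounds their total cost.\<close>

definition bfs_loop :: com where
  "bfs_loop =
     While (TNot (TAnd (TNot (NLess (NConst 0) (NReg ''f''))) (TNot (NLess (NReg ''qh'') (NReg ''qt'')))))
      (Cond (NLess (NConst 0) (NReg ''f''))
        (NAssign ''e'' (NMinus (NReg ''f'') (NConst 1)) ;;
         NAssign ''y'' (NRead ''head'' (NReg ''e'')) ;;
         Cond (TAnd (NLess (NRead ''pos'' (NReg ''y'')) (NReg ''qt''))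
                    (nat_eq (NRead ''queue'' (NRead ''pos'' (NReg ''y''))) (NReg ''y'')))
           Skip
           (NWrite ''queue'' (NReg ''qt'') (NReg ''y'') ;;
            NWrite ''pos'' (NReg ''y'') (NReg ''qt'') ;;
            NWrite ''hops'' (NReg ''y'') (NPlus (NRead ''hops'' (NReg ''x'')) (NConst 1)) ;;
            RWrite ''rhops'' (NReg ''y'') (RPlus (RRead ''rhops'' (NReg ''x'')) (RConst 1)) ;;
            NWrite ''par'' (NReg ''y'') (NReg ''e'') ;;
            incr ''qt'') ;;
         NAssign ''f'' (NRead ''next'' (NReg ''e'')))
        (NAssign ''x'' (NRead ''queue'' (NReg ''qh'')) ;;
         incr ''qh'' ;;
         NAssign ''f'' (NRead ''first'' (NReg ''x''))))"

definition bfs :: com where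
  "bfs =
     NWrite ''queue'' (NConst 0) (NReg ''z'') ;;
     NWrite ''pos'' (NReg ''z'') (NConst 0) ;;
     NWrite ''hops'' (NReg ''z'') (NConst 0) ;;
     RWrite ''rhops'' (NReg ''z'') (RConst 0) ;;
     NAssign ''x'' (NReg ''z'') ;;
     NAssign ''f'' (NRead ''first'' (NReg ''z'')) ;;
     NAssign ''qh'' (NConst 1) ;;
     NAssign ''qt'' (NConst 1) ;;
     bfs_loop"

text \<open>\<open>rk\<close> and \<open>rhops\<close> are real copies of \<open>k\<close> and
  \<open>hops\<close>, kept because no expression converts a natural number into a real.\<close>

definition search_round :: com where
  "search_round =
     relax ;; find_min ;; bfs ;;
     NAssign ''b'' (NReg ''c'') ;;
     NAssign ''u'' (NRead ''start'' (NPlus (NReg ''c'') (NReg ''z''))) ;;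
     incr ''k'' ;;
     RAssign ''rk'' (RPlus (RReg ''rk'') (RConst 1)) ;;
     RAssign ''thr'' (RTimes (RTimes (RConst 8) (RRead ''rhops'' (NReg ''u''))) (RReg ''wm''))"

definition search_loop :: com where
  "search_loop =
     While (RLess (RTimes (RReg ''eps'') (RReg ''rk'')) (RReg ''thr'')) search_round"

text \<open>As \<open>rk\<close> is 0 at first, the initial threshold 1 forces at least one
  round.\<close>

definition search :: com where
  "search =
     NAssign ''b'' (NConst 0) ;;
     NAssign ''k'' (NConst 0) ;;
     RAssign ''rk'' (RConst 0) ;;
     RAssign ''thr'' (RConst 1) ;;
     search_loop"

text \<open>The closed walk is written from its last edge backwards: first the \<open>k\<close>
  edges of the optimal walk, then, once \<open>b\<close> is 0, the breadth-first path that leads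
  from the end of that walk to its start.\<close>

definition trace_loop :: com where
  "trace_loop =
     While (NLess (NConst 0) (NReg ''i''))
      (NAssign ''i'' (NMinus (NReg ''i'') (NConst 1)) ;;
       Cond (NLess (NConst 0) (NReg ''b''))
         (NAssign ''e'' (NRead ''pred'' (NPlus (NReg ''b'') (NReg ''x''))) ;;
          NAssign ''b'' (NMinus (NReg ''b'') (NReg ''n'')))
         (NAssign ''e'' (NRead ''par'' (NReg ''x''))) ;;
       NWrite ''cyc'' (NReg ''i'') (NReg ''e'') ;;
       NAssign ''x'' (NRead ''tail'' (NReg ''e'')) ;;
       RAssign ''tot'' (RPlus (RReg ''tot'') (RRead ''w'' (NReg ''e''))) ;;
       RAssign ''len'' (RPlus (RReg ''len'') (RConst 1)))"

definition trace :: com where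
  "trace =
     NAssign ''i'' (NPlus (NReg ''k'') (NRead ''hops'' (NReg ''u''))) ;;
     NAssign ''x'' (NReg ''z'') ;;
     RAssign ''tot'' (RConst 0) ;;
     RAssign ''len'' (RConst 0) ;;
     trace_loop ;;
     RAssign ''lam'' (RDivide (RReg ''tot'') (RReg ''len''))"

definition push :: com where
  "push =
     NAssign ''e'' (NRead ''cyc'' (NReg ''i'')) ;;
     NWrite ''stack'' (NReg ''h'') (NReg ''e'') ;;
     NWrite ''pos'' (NRead ''tail'' (NReg ''e'')) (NReg ''h'') ;;
     RWrite ''pre'' (NPlus (NReg ''h'') (NConst 1))
       (RPlus (RRead ''pre'' (NReg ''h'')) (RMinus (RRead ''w'' (NReg ''e'')) (RReg ''lam''))) ;;
     incr ''h'' ;;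
     incr ''i'' ;;
     NAssign ''y'' (NRead ''head'' (NReg ''e''))"

text \<open>There is no test for the end of the walk: a loop of nonpositive excess over
  \<open>lam\<close> must show up before. Lowering \<open>h\<close> erases a loop;
  \<open>pos\<close> entries that become stale are rejected by the validity test.\<close>

definition erase_loop :: com where
  "erase_loop =
     While (RLess (RConst 0) (RReg ''dif''))
      (push ;;
       NAssign ''p'' (NRead ''pos'' (NReg ''y'')) ;;
       Cond (TAnd (NLess (NReg ''p'') (NReg ''h''))
                  (nat_eq (NRead ''tail'' (NRead ''stack'' (NReg ''p''))) (NReg ''y'')))
         (RAssign ''dif'' (RMinus (RRead ''pre'' (NReg ''h'')) (RRead ''pre'' (NReg ''p''))) ;;
          Cond (RLess (RConst 0) (RReg ''dif'')) (NAssign ''h'' (NReg ''p'')) Skip)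
         Skip)"

definition erase :: com where
  "erase =
     NAssign ''i'' (NConst 0) ;;
     NAssign ''h'' (NConst 0) ;;
     RWrite ''pre'' (NConst 0) (RConst 0) ;;
     RAssign ''dif'' (RConst 1) ;;
     erase_loop"

definition emit :: com where
  "emit =
     NAssign ''out_len'' (NConst 0) ;;
     While (NLess (NReg ''p'') (NReg ''h''))
      (NAssign ''e'' (NRead ''stack'' (NReg ''p'')) ;;
       NWrite ''out_tail'' (NReg ''out_len'') (NRead ''tail'' (NReg ''e'')) ;;
       NWrite ''out_head'' (NReg ''out_len'') (NRead ''head'' (NReg ''e'')) ;;
       incr ''p'' ;;
       incr ''out_len'')"

definition approx_min_mean_cycle :: com where
  "approx_min_mean_cycle =
     init_vertices ;; init_edges ;; search ;; trace ;; erase ;; emit"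


section \<open>Invariants of the search\<close>

text \<open>\<open>in_arc\<close> also covers a single vertex, where the mass of a normalized flow
  forces a loop. \<open>diam_le\<close> serves to bound the length of the closing path by
  \<open>m\<close>.\<close>

locale indexed_digraph =
  fixes n m d :: nat and T H :: "nat \<Rightarrow> nat" and w :: "nat \<Rightarrow> real" and eps wmax :: real
  assumes tail_less: "e < m \<Longrightarrow> T e < n"
    and head_less: "e < m \<Longrightarrow> H e < n"
    and in_arc: "v < n \<Longrightarrow> \<exists>e<m. H e = v"
    and n_pos: "0 < n"
    and eps_pos: "0 < eps"
    and weight_le: "e < m \<Longrightarrow> \<bar>w e\<bar> \<le> wmax"
    and diam: "u < n \<Longrightarrow> v < n \<Longrightarrow> \<exists>k\<le>d. (u, v) \<in> ((\<lambda>e. (T e, H e)) ` {..<m}) ^^ k"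
    and diam_le: "d \<le> n"
begin

text \<open>The heads of the edges cover all vertices. This absorbs costs per vertex into
  \<open>O(m)\<close>.\<close>

lemma n_le_m: "n \<le> m"
proof -
  have "{..<n} \<subseteq> H ` {..<m}" using in_arc by fastforce
  then have "card {..<n} \<le> card (H ` {..<m})" by (intro card_mono) auto
  also have "\<dots> \<le> card {..<m}" by (rule card_image_le) simp
  finally show ?thesis by simp
qed

lemma wmax_nonneg: "0 \<le> wmax"
  using weight_le[of 0] n_pos n_le_m by linarith

section \<open>Adjacency lists and breadth-first search\<close>

text \<open>Linked adjacency lists after reading the first \<open>i\<close> edges. Since the edges are prepended, a list
  pointer \<open>f\<close> for the vertex \<open>u\<close> represents all edges below \<open>f\<close> with tail \<open>u\<close>.\<close>

definition adj :: "nat \<Rightarrow> (nat \<Rightarrow> nat) \<Rightarrow> (nat \<Rightarrow> nat) \<Rightarrow> bool" where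
  "adj i first nxt \<longleftrightarrow>
     (\<forall>u<n. first u \<le> i \<and> (\<forall>e<i. T e = u \<longrightarrow> e < first u) \<and> (0 < first u \<longrightarrow> T (first u - 1) = u)) \<and>
     (\<forall>e<i. nxt e \<le> e \<and> (\<forall>e'<e. T e' = T e \<longrightarrow> e' < nxt e) \<and> (0 < nxt e \<longrightarrow> T (nxt e - 1) = T e))"

lemma adj_0: "(\<And>u. u < n \<Longrightarrow> first u = 0) \<Longrightarrow> adj 0 first nxt"
  by (simp add: adj_def)

lemma adj_Suc:
  assumes "adj e first nxt" "e < m"
  shows "adj (Suc e) (first(T e := Suc e)) (nxt(e := first (T e)))"
  using assms tail_less[of e] unfolding adj_def
  by (auto simp: less_Suc_eq le_Suc_eq)

text \<open>Positions below \<open>qh\<close> are dequeued, \<open>x\<close> being the last of them,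
  and \<open>f\<close> points to the unscanned rest of its list. Along the queue \<open>hops\<close>
  is monotone and exceeds \<open>hops x\<close> by at most 1, the usual two-level shape of a
  first-in first-out queue.\<close>

definition bfs_inv :: "nat \<Rightarrow> (nat \<Rightarrow> nat) \<Rightarrow> (nat \<Rightarrow> nat) \<Rightarrow> (nat \<Rightarrow> nat) \<Rightarrow> (nat \<Rightarrow> real) \<Rightarrow>
    (nat \<Rightarrow> nat) \<Rightarrow> nat \<Rightarrow> nat \<Rightarrow> nat \<Rightarrow> nat \<Rightarrow> bool" where
  "bfs_inv z q pos hops rhops par qh qt x f \<longleftrightarrow>
     0 < qh \<and> qh \<le> qt \<and> q 0 = z \<and> q (qh - 1) = x \<and> f \<le> m \<and> (0 < f \<longrightarrow> T (f - 1) = x) \<and>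
     hops z = 0 \<and>
     (\<forall>i<qt. q i < n \<and> pos (q i) = i \<and> hops (q i) \<le> hops x + 1 \<and> rhops (q i) = real (hops (q i))) \<and>
     (\<forall>j<qt. \<forall>i\<le>j. hops (q i) \<le> hops (q j)) \<and>
     (\<forall>i<qh. \<forall>e<m. T e = q i \<longrightarrow>
        T e = x \<and> e < f \<or> H e \<in> q ` {..<qt} \<and> hops (H e) \<le> hops (q i) + 1) \<and>
     (\<forall>i<qt. q i \<noteq> z \<longrightarrow> par (q i) < m \<and> H (par (q i)) = q i \<and>
        T (par (q i)) \<in> q ` {..<qt} \<and> hops (q i) = hops (T (par (q i))) + (1 :: nat))"

lemma bfs_invI:
  assumes "0 < qh" "qh \<le> qt" "q 0 = z" "q (qh - 1) = x" "f \<le> m" "0 < f \<Longrightarrow> T (f - 1) = x"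
    and "hops z = 0"
    and "\<And>i. i < qt \<Longrightarrow>
      q i < n \<and> pos (q i) = i \<and> hops (q i) \<le> hops x + 1 \<and> rhops (q i) = real (hops (q i))"
    and "\<And>i j. j < qt \<Longrightarrow> i \<le> j \<Longrightarrow> hops (q i) \<le> hops (q j)"
    and "\<And>i e. i < qh \<Longrightarrow> e < m \<Longrightarrow> T e = q i \<Longrightarrow>
      T e = x \<and> e < f \<or> H e \<in> q ` {..<qt} \<and> hops (H e) \<le> hops (q i) + 1"
    and "\<And>i. i < qt \<Longrightarrow> q i \<noteq> z \<Longrightarrow> par (q i) < m \<and> H (par (q i)) = q i \<and>
      T (par (q i)) \<in> q ` {..<qt} \<and> hops (q i) = hops (T (par (q i))) + 1"
  shows "bfs_inv z q pos hops rhops par qh qt x f"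
  unfolding bfs_inv_def using assms by simp

lemma bfs_invD:
  assumes "bfs_inv z q pos hops rhops par qh qt x f"
  shows "0 < qh" "qh \<le> qt" "q 0 = z" "q (qh - 1) = x" "f \<le> m" "0 < f \<Longrightarrow> T (f - 1) = x"
    and "hops z = 0"
    and "i < qt \<Longrightarrow>
      q i < n \<and> pos (q i) = i \<and> hops (q i) \<le> hops x + 1 \<and> rhops (q i) = real (hops (q i))"
    and "j < qt \<Longrightarrow> i \<le> j \<Longrightarrow> hops (q i) \<le> hops (q j)"
    and "i < qh \<Longrightarrow> e < m \<Longrightarrow> T e = q i \<Longrightarrow>
      T e = x \<and> e < f \<or> H e \<in> q ` {..<qt} \<and> hops (H e) \<le> hops (q i) + 1"
    and "i < qt \<Longrightarrow> q i \<noteq> z \<Longrightarrow> par (q i) < m \<and> H (par (q i)) = q i \<and>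
      T (par (q i)) \<in> q ` {..<qt} \<and> hops (q i) = hops (T (par (q i))) + 1"
  using assms unfolding bfs_inv_def by simp_all

text \<open>The edges still to be scanned: the potential that pays for the edge steps of the search.\<close>

definition bfs_left :: "(nat \<Rightarrow> nat) \<Rightarrow> nat \<Rightarrow> nat \<Rightarrow> nat \<Rightarrow> nat set" where
  "bfs_left q qh x f = {e. e < m \<and> (T e \<notin> q ` {..<qh} \<or> T e = x \<and> e < f)}"

lemma bfs_left_less:
  assumes "0 < f" "f \<le> m" "T (f - 1) = x" "x \<in> q ` {..<qh}" "f' < f"
  shows "Suc (card (bfs_left q qh x f')) \<le> card (bfs_left q qh x f)"
proof -
  have "finite (bfs_left q qh x f)" by (simp add: bfs_left_def)
  moreover have "bfs_left q qh x f' \<subset> bfs_left q qh x f"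
  proof (rule psubsetI)
    show "bfs_left q qh x f' \<subseteq> bfs_left q qh x f"
      using assms by (auto simp: bfs_left_def)
    have "f - 1 \<in> bfs_left q qh x f" "f - 1 \<notin> bfs_left q qh x f'"
      using assms by (auto simp: bfs_left_def)
    then show "bfs_left q qh x f' \<noteq> bfs_left q qh x f" by blast
  qed
  ultimately show ?thesis using psubset_card_mono Suc_leI by blast
qed

text \<open>\<open>pos\<close> inverts \<open>q\<close> on the queue, so no vertex is queued
  twice.\<close>

lemma bfs_inv_le:
  assumes "bfs_inv z q pos hops rhops par qh qt x f"
  shows "qt \<le> n"
proof -
  have "inj_on q {..<qt}"
    using bfs_invD(8)[OF assms] unfolding inj_on_def by (metis lessThan_iff)
  moreover have "q ` {..<qt} \<subseteq> {..<n}" using bfs_invD(8)[OF assms] by auto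
  ultimately have "card {..<qt} \<le> card {..<n}" by (metis card_inj_on_le finite_lessThan)
  then show ?thesis by simp
qed

lemma bfs_inv_init:
  assumes "z < n" "adj m first nxt"
  shows "bfs_inv z (q(0 := z)) (pos(z := 0)) (hops(z := 0)) (rhops(z := 0)) par 1 1 z (first z)"
proof -
  have "first z \<le> m" "0 < first z \<Longrightarrow> T (first z - 1) = z"
     "\<And>e. e < m \<Longrightarrow> T e = z \<Longrightarrow> e < first z"
    using assms by (auto simp: adj_def)
  then show ?thesis by (intro bfs_invI) (use \<open>z < n\<close> in simp_all)
qed

lemma bfs_inv_skip:
  assumes inv: "bfs_inv z q pos hops rhops par qh qt x f" and f: "0 < f" and adj: "adj m first nxt"
    and vis: "pos (H (f - 1)) < qt" "q (pos (H (f - 1))) = H (f - 1)"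
  shows "bfs_inv z q pos hops rhops par qh qt x (nxt (f - 1))"
proof -
  have fm: "f - 1 < m" and Tf: "T (f - 1) = x" using bfs_invD(5,6)[OF inv] f by auto
  have nx: "nxt (f - 1) \<le> m" "0 < nxt (f - 1) \<Longrightarrow> T (nxt (f - 1) - 1) = x"
    "\<And>e. e < f - 1 \<Longrightarrow> T e = x \<Longrightarrow> e < nxt (f - 1)"
    using adj fm Tf unfolding adj_def by (auto dest: order.trans)
  have *: "H (f - 1) \<in> q ` {..<qt}" "hops (H (f - 1)) \<le> hops x + 1"
  proof -
    show "H (f - 1) \<in> q ` {..<qt}" using vis by (metis imageI lessThan_iff)
    show "hops (H (f - 1)) \<le> hops x + 1" using bfs_invD(8)[OF inv vis(1)] vis(2) by simp
  qed
  \<comment> \<open>Only edge \<open>f - 1\<close> becomes scanned, since the list pointer passes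
    over no other edge with tail \<open>x\<close>. Its head is queued, hence at most one level above
    \<open>x\<close>.\<close>
  have edge: "H e \<in> q ` {..<qt} \<and> hops (H e) \<le> hops (q i) + 1"
    if "i < qh" "e < m" "T e = q i" "\<not> (T e = x \<and> e < nxt (f - 1))" for i e
  proof (cases "T e = x \<and> e < f")
    case True
    then have "e = f - 1" using that nx(3)[of e] by linarith
    then show ?thesis using * that Tf by simp
  next
    case False
    then show ?thesis using bfs_invD(10)[OF inv that(1-3)] by blast
  qed
  then have edge': "T e = x \<and> e < nxt (f - 1) \<or> H e \<in> q ` {..<qt} \<and> hops (H e) \<le> hops (q i) + 1"
    if "i < qh" "e < m" "T e = q i" for i e
    using that by blast
  show ?thesis
    using bfs_invD(1-4)[OF inv] nx(1,2) bfs_invD(7-9)[OF inv] edge' bfs_invD(11)[OF inv]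
    by (rule bfs_invI)
qed

lemma bfs_inv_visit:
  assumes inv: "bfs_inv z q pos hops rhops par qh qt x f" and f: "0 < f" and adj: "adj m first nxt"
    and y: "y = H (f - 1)" and new: "\<not> (pos y < qt \<and> q (pos y) = y)"
  shows "bfs_inv z (q(qt := y)) (pos(y := qt)) (hops(y := Suc (hops x))) (rhops(y := rhops x + 1))
     (par(y := f - 1)) qh (Suc qt) x (nxt (f - 1))"
proof -
  have fm: "f - 1 < m" and Tf: "T (f - 1) = x" using bfs_invD(5,6)[OF inv] f by auto
  have nx: "nxt (f - 1) \<le> m" "0 < nxt (f - 1) \<Longrightarrow> T (nxt (f - 1) - 1) = x"
    "\<And>e. e < f - 1 \<Longrightarrow> T e = x \<Longrightarrow> e < nxt (f - 1)"
    using adj fm Tf unfolding adj_def by (auto dest: order.trans)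
  have yn: "y < n" using y fm head_less by simp
  \<comment> \<open>Were \<open>y\<close> queued at position \<open>i\<close>, then
    \<open>pos y = i\<close> and the validity test would have succeeded.\<close>
  have yq: "q i \<noteq> y" if "i < qt" for i using bfs_invD(8)[OF inv that] new that by auto
  note qh = bfs_invD(2,1)[OF inv] and x = bfs_invD(4)[OF inv] and z = bfs_invD(3)[OF inv]
  have xy: "x \<noteq> y" using x yq[of "qh - 1"] qh by auto
  have zy: "z \<noteq> y" using z yq[of 0] qh by auto
  have xq: "x \<in> q ` {..<qt}" using x qh by auto
  have rx: "rhops x = real (hops x)" using bfs_invD(8)[OF inv] xq by auto
  have im: "(q(qt := y)) ` {..<Suc qt} = insert y (q ` {..<qt})"
    by (auto simp: lessThan_Suc image_iff)
  have edge: "H e = y \<and> q i = x \<or> H e \<in> q ` {..<qt} \<and> hops (H e) \<le> hops (q i) + 1"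
    if "i < qh" "e < m" "T e = q i" "\<not> (T e = x \<and> e < nxt (f - 1))" for i e
  proof (cases "T e = x \<and> e < f")
    case True
    then have "e = f - 1" using that nx(3)[of e] by linarith
    then show ?thesis using y that Tf by simp
  next
    case False
    then show ?thesis using bfs_invD(10)[OF inv that(1-3)] by blast
  qed
  let ?q = "q(qt := y)" and ?hops = "hops(y := Suc (hops x))" and ?par = "par(y := f - 1)"
  have old: "?q i = q i" "?hops (q i) = hops (q i)" "?par (q i) = par (q i)" if "i < qt" for i
    using that yq[of i] by auto
  have distQ: "?hops v = hops v" if "v \<in> q ` {..<qt}" for v
    using that yq by auto
  have A: "?q i < n \<and> (pos(y := qt)) (?q i) = i \<and> ?hops (?q i) \<le> ?hops x + 1 \<and>
      (rhops(y := rhops x + 1)) (?q i) = real (?hops (?q i))" if "i < Suc qt" for i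
  proof (cases "i = qt")
    case True
    then show ?thesis using yn xy rx by simp
  next
    case False
    then have "i < qt" using that by simp
    then show ?thesis using bfs_invD(8)[OF inv] old[of i] yq[of i] xy by auto
  qed
  \<comment> \<open>The new last entry lies one level above \<open>x\<close>, which the invariant
    makes an upper bound for all earlier ones.\<close>
  have B: "?hops (?q i) \<le> ?hops (?q j)" if "j < Suc qt" "i \<le> j" for i j
  proof (cases "j = qt")
    case True
    have "i = qt \<or> hops (q i) \<le> Suc (hops x)" 
      using bfs_invD(8)[OF inv, of i] that True by (cases "i = qt") auto
    then show ?thesis using True old(2)[of i] that by (cases "i = qt") auto
  next
    case False
    then show ?thesis using that bfs_invD(9)[OF inv, of j i] old[of i] old[of j] by auto
  qed
  have hx: "?hops x = hops x" using xy by simp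
  have C: "T e = x \<and> e < nxt (f - 1) \<or> H e \<in> ?q ` {..<Suc qt} \<and> ?hops (H e) \<le> ?hops (?q i) + 1"
    if "i < qh" "e < m" "T e = ?q i" for i e
  proof -
    have i: "i < qt" using that qh by simp
    have Te: "T e = q i" using that(3) i by simp
    show ?thesis
    proof (cases "T e = x \<and> e < nxt (f - 1)")
      case False
      from edge[OF that(1,2) Te this] show ?thesis
      proof
        assume "H e = y \<and> q i = x"
        then show ?thesis unfolding im using hx i by simp
      next
        assume "H e \<in> q ` {..<qt} \<and> hops (H e) \<le> hops (q i) + 1"
        then show ?thesis unfolding im using old[OF i] distQ[of "H e"] by simp
      qed
    qed simp
  qed
  have D: "?par (?q i) < m \<and> H (?par (?q i)) = ?q i \<and>
        T (?par (?q i)) \<in> ?q ` {..<Suc qt} \<and> ?hops (?q i) = ?hops (T (?par (?q i))) + 1"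
    if "i < Suc qt" "?q i \<noteq> z" for i
  proof (cases "i = qt")
    case True
    then show ?thesis unfolding im using fm Tf xy xq y by auto
  next
    case False
    then have i: "i < qt" using that by simp
    then have "par (q i) < m \<and> H (par (q i)) = q i \<and> T (par (q i)) \<in> q ` {..<qt} \<and>
        hops (q i) = hops (T (par (q i))) + 1"
      using bfs_invD(11)[OF inv i] that(2) old[OF i] by auto
    then show ?thesis unfolding im using old[OF i] distQ[of "T (par (q i))"] by auto
  qed
  have E: "0 < qh" "qh \<le> Suc qt" "?q 0 = z" "?q (qh - 1) = x"
    using qh x z zy by auto
  have F: "?hops z = 0" using bfs_invD(7)[OF inv] zy by simp
  show ?thesis
    using E nx(1,2) F A B C D by (rule bfs_invI)
qed

text \<open>The end of the list of \<open>x\<close> settles all edges out of dequeued vertices. The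
  edges out of the next vertex were already counted in \<open>bfs_left\<close>, as their tail was
  not dequeued before, so a dequeue creates no new work.\<close>

lemma bfs_inv_dequeue:
  assumes inv: "bfs_inv z q pos hops rhops par qh qt x 0" and adj: "adj m first nxt" and "qh < qt"
  shows "bfs_inv z q pos hops rhops par (Suc qh) qt (q qh) (first (q qh))"
    and "bfs_left q (Suc qh) (q qh) (first (q qh)) \<subseteq> bfs_left q qh x 0"
proof -
  have qn: "q qh < n" and mono: "hops x \<le> hops (q qh)"
    using bfs_invD(8)[OF inv \<open>qh < qt\<close>] bfs_invD(9)[OF inv \<open>qh < qt\<close>, of "qh - 1"]
      bfs_invD(4)[OF inv] by auto
  have fi: "first (q qh) \<le> m" "0 < first (q qh) \<Longrightarrow> T (first (q qh) - 1) = q qh"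
     "\<And>e. e < m \<Longrightarrow> T e = q qh \<Longrightarrow> e < first (q qh)"
    using adj qn by (auto simp: adj_def)
  have A: "T e = q qh \<and> e < first (q qh) \<or> H e \<in> q ` {..<qt} \<and> hops (H e) \<le> hops (q i) + 1"
    if "i < Suc qh" "e < m" "T e = q i" for i e
  proof (cases "i = qh")
    case False
    then have "i < qh" using that by simp
    then show ?thesis using bfs_invD(10)[OF inv _ that(2,3)] by blast
  qed (use fi(3) that in auto)
  have B: "hops (q i) \<le> hops (q qh) + 1" if "i < qt" for i
    using bfs_invD(8)[OF inv that] mono by linarith
  show "bfs_inv z q pos hops rhops par (Suc qh) qt (q qh) (first (q qh))"
  proof (rule bfs_invI)
    show "q i < n \<and> pos (q i) = i \<and> hops (q i) \<le> hops (q qh) + 1 \<and> rhops (q i) = real (hops (q i))"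
      if "i < qt" for i
      using bfs_invD(8)[OF inv that] B[OF that] by blast
  qed (use A fi \<open>qh < qt\<close> bfs_invD(3,7)[OF inv] bfs_invD(9,11)[OF inv] in \<open>simp; fail\<close>)+
  have "q i \<noteq> q qh" if "i < qh" for i
    using bfs_invD(8)[OF inv] \<open>qh < qt\<close> that by (metis less_trans nat_neq_iff)
  then show "bfs_left q (Suc qh) (q qh) (first (q qh)) \<subseteq> bfs_left q qh x 0"
    unfolding bfs_left_def by (auto simp: lessThan_Suc)
qed

text \<open>Instead of exact distances it records what is used later: \<open>hops y \<le> d\<close>
  bounds the threshold of the search, and the parent edges yield a path with \<open>hops y\<close>
  edges.\<close>

definition bfs_tree :: "nat \<Rightarrow> (nat \<Rightarrow> nat) \<Rightarrow> (nat \<Rightarrow> real) \<Rightarrow> (nat \<Rightarrow> nat) \<Rightarrow> bool" where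
  "bfs_tree z hops rhops par \<longleftrightarrow>
     (\<forall>y<n. hops y \<le> d \<and> rhops y = real (hops y) \<and>
        (y \<noteq> z \<longrightarrow> par y < m \<and> H (par y) = y \<and> hops y = hops (T (par y)) + (1 :: nat)))"

text \<open>The final queue is closed under edges and \<open>hops\<close> grows by at most 1 along
  an edge, so it is at most the length of any walk from \<open>z\<close>.\<close>

lemma bfs_inv_final:
  assumes inv: "bfs_inv z q pos hops rhops par qt qt x 0"
  shows "bfs_tree z hops rhops par"
proof -
  have z: "z = q 0" "0 < qt" "z < n" "hops z = 0"
    using bfs_invD(1,3,7)[OF inv] bfs_invD(8)[OF inv, of 0] by auto
  have edge: "H e \<in> q ` {..<qt} \<and> hops (H e) \<le> hops (T e) + 1" if "e < m" "T e \<in> q ` {..<qt}" for e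
    using bfs_invD(10)[OF inv] that by fastforce
  have *: "v \<in> q ` {..<qt} \<and> hops v \<le> k" if "(z, v) \<in> ((\<lambda>e. (T e, H e)) ` {..<m}) ^^ k" for k v
    using that
  proof (induction k arbitrary: v)
    case 0
    then show ?case using z by auto
  next
    case (Suc k)
    then obtain e where "e < m" "v = H e" "T e \<in> q ` {..<qt}" "hops (T e) \<le> k" by auto
    then show ?case using edge[of e] by auto
  qed
  have "y \<in> q ` {..<qt} \<and> hops y \<le> d" if "y < n" for y
    using diam[OF z(3) that] * by (meson le_trans)
  moreover have "rhops (q i) = real (hops (q i)) \<and> (q i \<noteq> z \<longrightarrow> par (q i) < m \<and> H (par (q i)) = q i \<and>
      hops (q i) = hops (T (par (q i))) + 1)" if "i < qt" for i
    using bfs_invD(8,11)[OF inv that] by blast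
  ultimately show ?thesis unfolding bfs_tree_def by blast
qed

section \<open>Minimum weights of walks with a given number of edges\<close>

text \<open>The Bellman recursion in local form: an inequality for every edge and an equality for
  the edge stored in \<open>A\<close>. Layer 0 is zero everywhere because walks may start at any
  vertex.\<close>

definition layers where
  "layers D S A K \<longleftrightarrow>
     (\<forall>v<n. D v = (0 :: real) \<and> S v = v) \<and>
     (\<forall>k<K. \<forall>v<n. A (Suc k * n + v) < m \<and> H (A (Suc k * n + v)) = v \<and>
        D (Suc k * n + v) = D (k * n + T (A (Suc k * n + v))) + w (A (Suc k * n + v)) \<and>
        S (Suc k * n + v) = S (k * n + T (A (Suc k * n + v)))) \<and>
     (\<forall>k<K. \<forall>e<m. D (Suc k * n + H e) \<le> D (k * n + T e) + w e)"

lemma layers_pred: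
  assumes "layers D S A K" "k < K" "v < n"
  obtains e where "e < m" "H e = v" "D (Suc k * n + v) = D (k * n + T e) + w e"
  using assms unfolding layers_def by blast

lemma layers_succ:
  assumes "layers D S A K" "k < K" "e < m"
  shows "D (Suc k * n + H e) \<le> D (k * n + T e) + w e"
  using assms unfolding layers_def by blast

lemma layers_0:
  assumes "layers D S A K" "v < n"
  shows "D v = 0"
  using assms unfolding layers_def by blast

text \<open>Deleting the first edge of an optimal walk leaves a walk with one edge less and the same
  end. The induction reaches the first edge by following last edges.\<close>

lemma layers_drop:
  assumes "layers D S A K"
  shows "k < K \<Longrightarrow> v < n \<Longrightarrow> D (k * n + v) \<le> D (Suc k * n + v) + wmax"
proof (induction k arbitrary: v)
  case 0
  then obtain e where "e < m" "D (Suc 0 * n + v) = D (0 * n + T e) + w e"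
    using layers_pred[OF assms] by metis
  then show ?case
    using layers_0[OF assms] 0 weight_le[of e] tail_less[of e] by simp
next
  case (Suc k)
  then obtain e where e: "e < m" "H e = v" "D (Suc (Suc k) * n + v) = D (Suc k * n + T e) + w e"
    using layers_pred[OF assms] by metis
  have "D (Suc k * n + v) \<le> D (k * n + T e) + w e"
    using layers_succ[OF assms _ e(1), of k] e(2) Suc.prems by simp
  also have "\<dots> \<le> D (Suc k * n + T e) + wmax + w e"
    using Suc.IH[of "T e"] Suc.prems e(1) tail_less by simp
  finally show ?case using e(3) by linarith
qed

text \<open>Appending an edge to an optimal walk and deleting its first edge raises the weight by at
  most \<open>2 * wmax\<close>. This is iterated along a path of at most \<open>d\<close>
  edges.\<close>

lemma layers_span:
  assumes lay: "layers D S A K" and "k \<le> K" "u < n" "v < n"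
  shows "D (k * n + v) \<le> D (k * n + u) + 2 * d * wmax"
proof -
  have edge: "D (k * n + H e) \<le> D (k * n + T e) + 2 * wmax" if "e < m" for e
  proof (cases k)
    case 0
    then show ?thesis using layers_0[OF lay] that tail_less head_less wmax_nonneg by simp
  next
    case (Suc j)
    then show ?thesis
      using layers_succ[OF lay _ that, of j] layers_drop[OF lay, of j "T e"] \<open>k \<le> K\<close> that
        tail_less[OF that] weight_le[OF that] by (simp add: abs_le_iff)
  qed
  have path: "D (k * n + v) \<le> D (k * n + u) + 2 * i * wmax"
    if "(u, v) \<in> ((\<lambda>e. (T e, H e)) ` {..<m}) ^^ i" for i v
    using that
  proof (induction i arbitrary: v)
    case (Suc i)
    then obtain e where "e < m" "v = H e" "D (k * n + T e) \<le> D (k * n + u) + 2 * i * wmax"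
      by auto
    then show ?case using edge[of e] by (simp add: algebra_simps)
  qed simp
  obtain i where i: "i \<le> d" "(u, v) \<in> ((\<lambda>e. (T e, H e)) ` {..<m}) ^^ i"
    using diam assms by blast
  have "2 * real i * wmax \<le> 2 * real d * wmax"
    using i(1) wmax_nonneg by (intro mult_right_mono) auto
  then show ?thesis using path[OF i(2)] by linarith
qed

text \<open>Summing the relaxation inequalities against the flow telescopes over the layers up to the
  imbalance, so no cycle decomposition of the flow is needed.\<close>

lemma layers_min_le_flow:
  fixes p :: "nat \<Rightarrow> real"
  assumes lay: "layers D S A K" and p_nonneg: "\<And>e. e < m \<Longrightarrow> 0 \<le> p e" and p_sum: "(\<Sum>e<m. p e) = 1"
    and z: "z < n" "\<And>v. v < n \<Longrightarrow> D (K * n + z) \<le> D (K * n + v)"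
  defines "\<delta> \<equiv> \<Sum>v<n. \<bar>(\<Sum>e\<in>{e\<in>{..<m}. T e = v}. p e) - (\<Sum>e\<in>{e\<in>{..<m}. H e = v}. p e)\<bar>"
  shows "D (K * n + z) \<le> K * ((\<Sum>e<m. p e * w e) + 2 * d * wmax * \<delta>)"
proof -
  define F where "F = (\<Sum>e<m. p e * w e)"
  \<comment> \<open>\<open>r\<close> and \<open>c\<close> are the outflow and inflow of a vertex;
    \<open>b k\<close> and \<open>a k\<close> are the averages of layer \<open>k\<close> over the
    tails and over the heads under the flow.\<close>
  define r where "r v = (\<Sum>e\<in>{e\<in>{..<m}. T e = v}. p e)" for v
  define c where "c v = (\<Sum>e\<in>{e\<in>{..<m}. H e = v}. p e)" for v
  define a where "a k = (\<Sum>e<m. p e * D (k * n + H e))" for k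
  define b where "b k = (\<Sum>e<m. p e * D (k * n + T e))" for k
  have out: "(\<Sum>e<m. p e * g (T e)) = (\<Sum>v<n. r v * g v)" for g
  proof -
    have "(\<Sum>v<n. r v * g v) = (\<Sum>v<n. \<Sum>e\<in>{e\<in>{..<m}. T e = v}. p e * g (T e))"
      unfolding r_def sum_distrib_right by (intro sum.cong) auto
    also have "\<dots> = (\<Sum>e<m. p e * g (T e))"
      by (rule sum.group) (auto simp: tail_less)
    finally show ?thesis by simp
  qed
  have inn: "(\<Sum>e<m. p e * g (H e)) = (\<Sum>v<n. c v * g v)" for g
  proof -
    have "(\<Sum>v<n. c v * g v) = (\<Sum>v<n. \<Sum>e\<in>{e\<in>{..<m}. H e = v}. p e * g (H e))"
      unfolding c_def sum_distrib_right by (intro sum.cong) auto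
    also have "\<dots> = (\<Sum>e<m. p e * g (H e))"
      by (rule sum.group) (auto simp: head_less)
    finally show ?thesis by simp
  qed
  have \<delta>: "\<delta> = (\<Sum>v<n. \<bar>r v - c v\<bar>)" by (simp add: \<delta>_def r_def c_def)
  have \<delta>_nonneg: "0 \<le> 2 * d * wmax * \<delta>"
    unfolding \<delta> using wmax_nonneg by (intro mult_nonneg_nonneg sum_nonneg) auto
  have ab: "a (Suc k) \<le> b k + F" if "k < K" for k
  proof -
    have "a (Suc k) \<le> (\<Sum>e<m. p e * (D (k * n + T e) + w e))"
      unfolding a_def using layers_succ[OF lay that] p_nonneg
      by (intro sum_mono mult_left_mono) auto
    then show ?thesis unfolding b_def F_def by (simp add: algebra_simps sum.distrib)
  qed
  have ba: "b k \<le> a k + 2 * d * wmax * \<delta>" if "k \<le> K" for k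
  proof -
    \<comment> \<open>Subtracting the value at vertex 0 does not change \<open>b k - a k\<close> and
      bounds all entries by the span of the layer.\<close>
    let ?g = "\<lambda>v. D (k * n + v) - D (k * n + 0)"
    have "b k - a k = (\<Sum>e<m. p e * ?g (T e)) - (\<Sum>e<m. p e * ?g (H e))"
      unfolding a_def b_def by (simp add: sum_subtractf right_diff_distrib)
    also have "\<dots> = (\<Sum>v<n. (r v - c v) * ?g v)"
      unfolding out[of ?g] inn[of ?g] by (simp add: sum_subtractf left_diff_distrib)
    also have "\<dots> \<le> (\<Sum>v<n. \<bar>r v - c v\<bar> * (2 * d * wmax))"
    proof (rule sum_mono)
      fix v assume "v \<in> {..<n}"
      then have "\<bar>?g v\<bar> \<le> 2 * d * wmax"
        using layers_span[OF lay that, of 0 v] layers_span[OF lay that, of v 0] n_pos by simp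
      then have "\<bar>(r v - c v) * ?g v\<bar> \<le> \<bar>r v - c v\<bar> * (2 * d * wmax)"
        unfolding abs_mult by (intro mult_left_mono) auto
      then show "(r v - c v) * ?g v \<le> \<bar>r v - c v\<bar> * (2 * d * wmax)" by linarith
    qed
    also have "\<dots> = 2 * d * wmax * \<delta>" unfolding \<delta> sum_distrib_left
      by (intro sum.cong) (simp_all add: mult_ac)
    finally show ?thesis by linarith
  qed
  \<comment> \<open>Layer 0 vanishes, so the first step incurs no imbalance; each later step costs
    \<open>F\<close> and one imbalance term.\<close>
  have aK: "k < K \<Longrightarrow> a (Suc k) \<le> Suc k * (F + 2 * d * wmax * \<delta>)" for k
  proof (induction k)
    case 0
    have "b 0 = 0" unfolding b_def using layers_0[OF lay] tail_less by simp
    then have "a (Suc 0) \<le> F" using ab[of 0] 0 by simp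
    then have "a (Suc 0) \<le> F + 2 * d * wmax * \<delta>" using \<delta>_nonneg by linarith
    then show ?case by simp
  next
    case (Suc k)
    have "a (Suc (Suc k)) \<le> a (Suc k) + 2 * d * wmax * \<delta> + F"
      using ab[of "Suc k"] ba[of "Suc k"] Suc.prems by linarith
    also have "\<dots> \<le> Suc k * (F + 2 * d * wmax * \<delta>) + 2 * d * wmax * \<delta> + F"
      using Suc by simp
    also have "\<dots> = Suc (Suc k) * (F + 2 * d * wmax * \<delta>)" by (simp add: algebra_simps)
    finally show ?case .
  qed
  \<comment> \<open>A minimum is at most the average under the flow, whose total is 1.\<close>
  have "D (K * n + z) = (\<Sum>e<m. p e * D (K * n + z))"
    unfolding sum_distrib_right[symmetric] p_sum by simp
  also have "\<dots> \<le> a K"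
    unfolding a_def using z(2) head_less p_nonneg by (intro sum_mono mult_left_mono) auto
  finally have le: "D (K * n + z) \<le> a K" .
  show ?thesis
  proof (cases K)
    case 0
    then show ?thesis using layers_0[OF lay z(1)] by simp
  next
    case (Suc k)
    then show ?thesis using le aK[of k] unfolding F_def by simp
  qed
qed

text \<open>\<open>D0\<close>, \<open>S0\<close> and \<open>A0\<close> are the tables before the
  round. Of the new layer only the cells at heads of scanned edges are described; the others may
  contain anything.\<close>

definition relax_inv :: "(nat \<Rightarrow> real) \<Rightarrow> (nat \<Rightarrow> nat) \<Rightarrow> (nat \<Rightarrow> nat) \<Rightarrow> nat \<Rightarrow> nat \<Rightarrow>
    (nat \<Rightarrow> real) \<Rightarrow> (nat \<Rightarrow> nat) \<Rightarrow> (nat \<Rightarrow> nat) \<Rightarrow> bool" where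
  "relax_inv D0 S0 A0 k e D S A \<longleftrightarrow>
     (\<forall>i<Suc k * n. D i = D0 i \<and> S i = S0 i \<and> A i = A0 i) \<and>
     (\<forall>e'<e. A (Suc k * n + H e') < e \<and> H (A (Suc k * n + H e')) = H e' \<and>
        D (Suc k * n + H e') = D0 (k * n + T (A (Suc k * n + H e'))) + w (A (Suc k * n + H e')) \<and>
        S (Suc k * n + H e') = S0 (k * n + T (A (Suc k * n + H e'))) \<and>
        D (Suc k * n + H e') \<le> D0 (k * n + T e') + w e')"

lemma relax_inv_0: "relax_inv D S A k 0 D S A"
  by (simp add: relax_inv_def)

text \<open>The validity test shows that the stored edge is an already scanned edge with the same
  head, and the invariant at that edge describes the cell.\<close>

lemma relax_inv_skip:
  assumes inv: "relax_inv D0 S0 A0 k e D S A" and e: "e < m"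
    and "A (Suc k * n + H e) < e" "H (A (Suc k * n + H e)) = H e"
    and "D (Suc k * n + H e) \<le> D (k * n + T e) + w e"
  shows "relax_inv D0 S0 A0 k (Suc e) D S A"
proof -
  have "D (k * n + T e) = D0 (k * n + T e)"
    using inv tail_less[OF e] by (auto simp: relax_inv_def)
  moreover have "A (Suc k * n + H e) < Suc e \<and>
      D (Suc k * n + H e) = D0 (k * n + T (A (Suc k * n + H e))) + w (A (Suc k * n + H e)) \<and>
      S (Suc k * n + H e) = S0 (k * n + T (A (Suc k * n + H e)))"
    using inv assms(3,4) unfolding relax_inv_def by (metis less_Suc_eq)
  ultimately show ?thesis
    using inv assms(4,5) unfolding relax_inv_def by (auto simp: less_Suc_eq)
qed

lemma relax_inv_update:
  fixes k e defines "v \<equiv> Suc k * n + H e"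
  assumes inv: "relax_inv D0 S0 A0 k e D S A" and e: "e < m"
    and "\<not> (A v < e \<and> H (A v) = H e \<and> D v \<le> D (k * n + T e) + w e)"
  shows "relax_inv D0 S0 A0 k (Suc e) (D(v := D (k * n + T e) + w e)) (S(v := S (k * n + T e))) (A(v := e))"
proof -
  have old: "D (k * n + T e) = D0 (k * n + T e)" "S (k * n + T e) = S0 (k * n + T e)"
    using inv tail_less[OF e] by (auto simp: relax_inv_def)
  \<comment> \<open>An earlier edge into the same vertex makes the entry valid, so the test can only
    have failed because the new value is smaller.\<close>
  have "D0 (k * n + T e) + w e \<le> D0 (k * n + T e') + w e'" if "e' < e" "H e' = H e" for e'
  proof -
    have "A v < e" "H (A v) = H e" "D v \<le> D0 (k * n + T e') + w e'"
      using inv that unfolding relax_inv_def v_def by metis+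
    then show ?thesis using assms(4) old by auto
  qed
  then show ?thesis
    using inv unfolding relax_inv_def v_def by (auto simp: less_Suc_eq old)
qed

lemma relax_inv_final:
  assumes inv: "relax_inv D0 S0 A0 k m D S A" and lay: "layers D0 S0 A0 k"
  shows "layers D S A (Suc k)"
proof -
  have cell: "j * n + v < Suc k * n" if "j \<le> k" "v < n" for j v
  proof -
    have "j * n + v < Suc j * n" using that by simp
    also have "\<dots> \<le> Suc k * n" using that by (intro mult_right_mono) auto
    finally show ?thesis .
  qed
  have old: "D (j * n + v) = D0 (j * n + v)" "S (j * n + v) = S0 (j * n + v)" "A (j * n + v) = A0 (j * n + v)"
    if "j \<le> k" "v < n" for j v
    using inv cell[OF that] by (auto simp: relax_inv_def)
  have 0: "D v = 0 \<and> S v = v" if "v < n" for v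
    using old[of 0 v] that lay by (simp add: layers_def)
  have 1: "A (Suc j * n + v) < m \<and> H (A (Suc j * n + v)) = v \<and>
        D (Suc j * n + v) = D (j * n + T (A (Suc j * n + v))) + w (A (Suc j * n + v)) \<and>
        S (Suc j * n + v) = S (j * n + T (A (Suc j * n + v)))" if "j < Suc k" "v < n" for j v
  proof (cases "j = k")
    case True
    \<comment> \<open>Every cell of the new layer has been written, since each vertex is the head of
      some edge.\<close>
    obtain e where "e < m" "H e = v" using in_arc \<open>v < n\<close> by blast
    then show ?thesis
      using inv True old[of k] tail_less unfolding relax_inv_def by (metis order_refl)
  next
    case False
    then have "j < k" using that by simp
    then show ?thesis
      using lay that old[of "Suc j" v] old[of j] tail_less unfolding layers_def
      by (metis Suc_leI less_imp_le_nat)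
  qed
  have 2: "D (Suc j * n + H e) \<le> D (j * n + T e) + w e" if "j < Suc k" "e < m" for j e
  proof (cases "j = k")
    case True
    then show ?thesis
      using inv that old[of k "T e"] tail_less unfolding relax_inv_def by auto
  next
    case False
    then have "j < k" using that by simp
    then show ?thesis
      using layers_succ[OF lay _ that(2), of j] old[of "Suc j" "H e"] old[of j "T e"] that
        tail_less head_less by auto
  qed
  show ?thesis unfolding layers_def using 0 1 2 by blast
qed

section \<open>Tracing the closed walk backwards\<close>

definition closed_walk :: "(nat \<Rightarrow> nat) \<Rightarrow> nat \<Rightarrow> nat \<Rightarrow> bool" where
  "closed_walk cyc L z \<longleftrightarrow> 0 < L \<and> T (cyc 0) = z \<and>
     (\<forall>j<L. cyc j < m \<and> H (cyc j) = (if Suc j < L then T (cyc (Suc j)) else z))"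

text \<open>For \<open>0 < k\<close> the trace is in layer \<open>k\<close> of the optimal walk, and
  the collected weight complements the table entry. For \<open>k = 0\<close> it is on the
  breadth-first path, each edge of which adds at most \<open>wm\<close>.\<close>

definition trace_inv :: "(nat \<Rightarrow> real) \<Rightarrow> (nat \<Rightarrow> nat) \<Rightarrow> nat \<Rightarrow> nat \<Rightarrow> nat \<Rightarrow> (nat \<Rightarrow> nat) \<Rightarrow> real \<Rightarrow>
    nat \<Rightarrow> nat \<Rightarrow> nat \<Rightarrow> real \<Rightarrow> real \<Rightarrow> (nat \<Rightarrow> nat) \<Rightarrow> bool" where
  "trace_inv D S K z u hops wm b i x tot len cyc \<longleftrightarrow>
     x < n \<and> i \<le> K + hops u \<and>
     (\<exists>k. b = k * n \<and> k \<le> K \<and>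
       (if 0 < k then i = hops u + k \<and> S (k * n + x) = u \<and> tot + D (k * n + x) = D (K * n + z)
        else hops x = i \<and> i \<le> hops u \<and> tot \<le> D (K * n + z) + (real (hops u) - real i) * wm)) \<and>
     x = (if i < K + hops u then T (cyc i) else z) \<and>
     (\<forall>j. i \<le> j \<and> j < K + hops u \<longrightarrow> cyc j < m \<and>
       H (cyc j) = (if Suc j < K + hops u then T (cyc (Suc j)) else z)) \<and>
     tot = (\<Sum>j=i..<K + hops u. w (cyc j)) \<and> len = real (K + hops u) - real i"

lemma trace_inv_cases:
  assumes "trace_inv D S K z u hops wm b i x tot len cyc"
  obtains (walk) k where "k < K" "b = Suc k * n" "i = hops u + Suc k" "S (Suc k * n + x) = u"
      "tot + D (Suc k * n + x) = D (K * n + z)"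
    | (path) "b = 0" "hops x = i" "i \<le> hops u" "tot \<le> D (K * n + z) + (real (hops u) - real i) * wm"
proof -
  obtain k where k: "b = k * n" "k \<le> K"
    "if 0 < k then i = hops u + k \<and> S (k * n + x) = u \<and> tot + D (k * n + x) = D (K * n + z)
     else hops x = i \<and> i \<le> hops u \<and> tot \<le> D (K * n + z) + (real (hops u) - real i) * wm"
    using assms unfolding trace_inv_def by blast
  show ?thesis
  proof (cases k)
    case 0
    then show ?thesis using k path by simp
  next
    case (Suc j)
    then show ?thesis using k by (intro walk[of j]) simp_all
  qed
qed

lemma trace_inv_init:
  assumes "0 < K" "z < n" "u = S (K * n + z)"
  shows "trace_inv D S K z u hops wm (K * n) (K + hops u) z 0 0 cyc"
  unfolding trace_inv_def using assms by auto

lemma trace_inv_extend: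
  assumes inv: "trace_inv D S K z u hops wm b (Suc i) x tot len cyc"
    and e: "e < m" "H e = x"
    and k: "b' = k * n" "k \<le> K"
      "if 0 < k then i = hops u + k \<and> S (k * n + T e) = u \<and> tot + w e + D (k * n + T e) = D (K * n + z)
       else hops (T e) = i \<and> i \<le> hops u \<and> tot + w e \<le> D (K * n + z) + (real (hops u) - real i) * wm"
  shows "trace_inv D S K z u hops wm b' i (T e) (tot + w e) (len + 1) (cyc(i := e))"
proof -
  have i: "i < K + hops u" using inv by (simp add: trace_inv_def)
  have "(\<Sum>j=i..<K + hops u. w ((cyc(i := e)) j)) = w e + (\<Sum>j=Suc i..<K + hops u. w (cyc j))"
    using i by (subst sum.atLeast_Suc_lessThan) auto
  moreover have "(cyc(i := e)) j < m \<and>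
      H ((cyc(i := e)) j) = (if Suc j < K + hops u then T ((cyc(i := e)) (Suc j)) else z)"
    if "i \<le> j" "j < K + hops u" for j
    using inv e that unfolding trace_inv_def by (cases "j = i") auto
  ultimately show ?thesis
    using inv e(1) tail_less[OF e(1)] k i unfolding trace_inv_def by auto
qed

lemma trace_inv_walk:
  assumes inv: "trace_inv D S K z u hops wm b i x tot len cyc" and "0 < i" "0 < b"
    and lay: "layers D S A K"
  shows "trace_inv D S K z u hops wm (b - n) (i - 1) (T (A (b + x))) (tot + w (A (b + x))) (len + 1)
     (cyc(i - 1 := A (b + x)))"
proof -
  have x: "x < n" using inv unfolding trace_inv_def by blast
  from inv obtain j where j: "j < K" "b = Suc j * n" "i = hops u + Suc j" "S (Suc j * n + x) = u"
    "tot + D (Suc j * n + x) = D (K * n + z)"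
    by (cases rule: trace_inv_cases) (use \<open>0 < b\<close> in auto)
  have A: "A (b + x) < m" "H (A (b + x)) = x" "D (b + x) = D (j * n + T (A (b + x))) + w (A (b + x))"
      "S (b + x) = S (j * n + T (A (b + x)))"
    using lay j(1) x unfolding layers_def j(2) by blast+
  have inv': "trace_inv D S K z u hops wm b (Suc (i - 1)) x tot len cyc" using inv \<open>0 < i\<close> by simp
  show ?thesis
  proof (rule trace_inv_extend[OF inv' A(1,2)])
    show "b - n = j * n" "j \<le> K" using j by auto
    show "if 0 < j then i - 1 = hops u + j \<and> S (j * n + T (A (b + x))) = u \<and>
        tot + w (A (b + x)) + D (j * n + T (A (b + x))) = D (K * n + z)
      else hops (T (A (b + x))) = i - 1 \<and> i - 1 \<le> hops u \<and>
        tot + w (A (b + x)) \<le> D (K * n + z) + (real (hops u) - real (i - 1)) * wm"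
    \<comment> \<open>In layer 0 the start of the walk is the vertex itself, so \<open>u\<close> is
      reached and the trace passes to the breadth-first path.\<close>
    proof (cases j)
      case 0
      then have "D (T (A (b + x))) = 0" "S (T (A (b + x))) = T (A (b + x))"
        using lay tail_less[OF A(1)] unfolding layers_def by auto
      then show ?thesis using 0 j A by auto
    next
      case (Suc i)
      then show ?thesis using j A by auto
    qed
  qed
qed

lemma trace_inv_path:
  assumes inv: "trace_inv D S K z u hops wm 0 i x tot len cyc" and "0 < i"
    and tree: "bfs_tree z hops rhops par" "hops z = 0" and wm: "\<And>e. e < m \<Longrightarrow> \<bar>w e\<bar> \<le> wm"
  shows "trace_inv D S K z u hops wm 0 (i - 1) (T (par x)) (tot + w (par x)) (len + 1)
     (cyc(i - 1 := par x))"
proof -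
  have xn: "x < n" using inv unfolding trace_inv_def by blast
  from inv have x: "hops x = i" "i \<le> hops u" "tot \<le> D (K * n + z) + (real (hops u) - real i) * wm"
    by (cases rule: trace_inv_cases, use n_pos in auto)+
  have "x \<noteq> z" using x(1) tree(2) \<open>0 < i\<close> by auto
  then have par: "par x < m" "H (par x) = x" "hops x = hops (T (par x)) + 1"
    using tree(1) xn unfolding bfs_tree_def by auto
  have "tot + w (par x) \<le> D (K * n + z) + (real (hops u) - real i) * wm + wm"
    using x(3) wm[OF par(1)] by linarith
  also have "\<dots> = D (K * n + z) + (real (hops u) - real (i - 1)) * wm"
    using \<open>0 < i\<close> by (simp add: of_nat_diff Suc_leI algebra_simps)
  finally have tot: "tot + w (par x) \<le> \<dots>" .
  have inv': "trace_inv D S K z u hops wm 0 (Suc (i - 1)) x tot len cyc" using inv \<open>0 < i\<close> by simp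
  show ?thesis
    by (rule trace_inv_extend[OF inv' par(1,2), of _ 0]) (use par x tot in simp_all)
qed

lemma trace_inv_final:
  assumes inv: "trace_inv D S K z u hops wm b 0 x tot len cyc" and "0 < K" "z < n"
    and tree: "bfs_tree z hops rhops par"
  shows "closed_walk cyc (K + hops u) z" "len = real (K + hops u)" "tot = (\<Sum>j<K + hops u. w (cyc j))"
    "tot \<le> D (K * n + z) + hops u * wm"
proof -
  from inv have x: "hops x = 0" "tot \<le> D (K * n + z) + hops u * wm"
    by (cases rule: trace_inv_cases, auto)+
  have xn: "x < n" "x = T (cyc 0)" using inv \<open>0 < K\<close> unfolding trace_inv_def by auto
  \<comment> \<open>Only the root can have \<open>hops\<close> 0, since every other vertex lies one
    above its parent.\<close>
  then have "x = z" using tree x(1) unfolding bfs_tree_def by fastforce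
  then show "closed_walk cyc (K + hops u) z"
    using inv xn(2) \<open>0 < K\<close> unfolding trace_inv_def closed_walk_def by auto
  show "len = real (K + hops u)" "tot = (\<Sum>j<K + hops u. w (cyc j))"
    using inv unfolding trace_inv_def by (auto simp: atLeast0LessThan)
  show "tot \<le> D (K * n + z) + hops u * wm" by (fact x(2))
qed

section \<open>Erasing loops from the closed walk\<close>

text \<open>
  The stack is the loop erasure of the first \<open>i\<close> edges of the closed walk, and \<open>pre\<close> holds its prefix
  sums of \<open>w - lam\<close>. Only loops of positive weight are erased, so the walk weighs strictly more than
  the stack once something was erased; as the whole walk has weight \<open>0\<close>, it cannot be erased completely.
\<close>

definition stacked :: "(nat \<Rightarrow> nat) \<Rightarrow> nat \<Rightarrow> nat \<Rightarrow> real \<Rightarrow> nat \<Rightarrow> nat \<Rightarrow> (nat \<Rightarrow> nat) \<Rightarrow> (nat \<Rightarrow> nat) \<Rightarrow>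
    (nat \<Rightarrow> real) \<Rightarrow> bool" where
  "stacked cyc L z lam i h st pos pre \<longleftrightarrow> i \<le> L \<and> h \<le> i \<and>
     (\<forall>j<h. st j < m \<and> pos (T (st j)) = j \<and> pre (Suc j) = pre j + (w (st j) - lam) \<and>
       H (st j) = (if Suc j < h then T (st (Suc j)) else if i < L then T (cyc i) else z)) \<and>
     (if 0 < h then T (st 0) else if i < L then T (cyc i) else z) = z \<and>
     pre 0 = 0 \<and> pre h \<le> (\<Sum>j<i. w (cyc j) - lam) \<and> (pre h = (\<Sum>j<i. w (cyc j) - lam) \<longrightarrow> h = i)"

text \<open>\<open>stacked\<close> still lets the vertex just reached occur on the stack; excluding
  it makes the stack a simple path.\<close>

definition erase_inv :: "(nat \<Rightarrow> nat) \<Rightarrow> nat \<Rightarrow> nat \<Rightarrow> real \<Rightarrow> nat \<Rightarrow> nat \<Rightarrow> (nat \<Rightarrow> nat) \<Rightarrow> (nat \<Rightarrow> nat) \<Rightarrow>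
    (nat \<Rightarrow> real) \<Rightarrow> bool" where
  "erase_inv cyc L z lam i h st pos pre \<longleftrightarrow> stacked cyc L z lam i h st pos pre \<and>
     (\<forall>j<h. T (st j) \<noteq> (if i < L then T (cyc i) else z))"

definition light_cycle :: "(nat \<Rightarrow> nat) \<Rightarrow> real \<Rightarrow> nat \<Rightarrow> nat \<Rightarrow> bool" where
  "light_cycle st lam p h \<longleftrightarrow> p < h \<and> inj_on (\<lambda>j. T (st j)) {p..<h} \<and>
     (\<forall>j. p \<le> j \<and> j < h \<longrightarrow> st j < m \<and> H (st j) = (if Suc j < h then T (st (Suc j)) else T (st p))) \<and>
     (\<Sum>j=p..<h. w (st j)) \<le> lam * (real h - real p)"

lemma erase_inv_init:
  assumes "closed_walk cyc L z"
  shows "erase_inv cyc L z lam 0 0 st pos (pre(0 := 0))"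
  using assms by (simp add: erase_inv_def stacked_def closed_walk_def)

text \<open>At \<open>i = L\<close> the current vertex is \<open>z\<close>, which also starts every
  nonempty stack, so the stack is empty. Its weight 0 equals that of the whole walk, which happens
  only if nothing was erased, contradicting \<open>0 < L\<close>.\<close>

lemma erase_inv_less:
  assumes "erase_inv cyc L z lam i h st pos pre" "0 < L" "(\<Sum>j<L. w (cyc j) - lam) = 0"
  shows "i < L"
proof (rule ccontr)
  assume "\<not> i < L"
  then have "i = L" "h = 0" using assms unfolding erase_inv_def stacked_def by (auto split: if_splits)
  then show False using assms unfolding erase_inv_def stacked_def by auto
qed

lemma erase_push:
  assumes inv: "erase_inv cyc L z lam i h st pos pre" and walk: "closed_walk cyc L z" and i: "i < L"
  shows "stacked cyc L z lam (Suc i) (Suc h) (st(h := cyc i)) (pos(T (cyc i) := h))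
     (pre(Suc h := pre h + (w (cyc i) - lam)))"
    and "H (cyc i) = (if Suc i < L then T (cyc (Suc i)) else z)"
proof -
  show Hi: "H (cyc i) = (if Suc i < L then T (cyc (Suc i)) else z)"
    using walk i by (simp add: closed_walk_def)
  have cm: "cyc i < m" using walk i by (simp add: closed_walk_def)
  have st: "stacked cyc L z lam i h st pos pre" and ne: "\<And>j. j < h \<Longrightarrow> T (st j) \<noteq> T (cyc i)"
    using inv i by (auto simp: erase_inv_def)
  show "stacked cyc L z lam (Suc i) (Suc h) (st(h := cyc i)) (pos(T (cyc i) := h))
     (pre(Suc h := pre h + (w (cyc i) - lam)))"
    using st ne i cm Hi unfolding stacked_def by (auto simp: less_Suc_eq)
qed

lemma stacked_new:
  assumes st: "stacked cyc L z lam i h st pos pre" and y: "y = (if i < L then T (cyc i) else z)"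
    and "\<not> (pos y < h \<and> T (st (pos y)) = y)"
  shows "erase_inv cyc L z lam i h st pos pre"
proof -
  have "T (st j) \<noteq> y" if "j < h" for j
  proof
    assume "T (st j) = y"
    moreover have "pos (T (st j)) = j" using st that unfolding stacked_def by blast
    ultimately show False using assms(3) that by simp
  qed
  then show ?thesis using st unfolding erase_inv_def y by blast
qed

text \<open>The erased loop has positive excess, so the remaining prefix sum is strictly below that
  of the walk and the equality clause of \<open>stacked\<close> becomes vacuous.\<close>

lemma stacked_pop:
  assumes st: "stacked cyc L z lam i h st pos pre" and y: "y = (if i < L then T (cyc i) else z)"
    and p: "pos y < h" "T (st (pos y)) = y" "0 < pre h - pre (pos y)"
  shows "erase_inv cyc L z lam i (pos y) st pos pre"
proof -
  have "T (st j) \<noteq> y" if "j < pos y" for j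
    using st that p unfolding stacked_def by (metis less_trans nat_neq_iff)
  moreover have "stacked cyc L z lam i (pos y) st pos pre"
  proof -
    have "H (st j) = (if Suc j < pos y then T (st (Suc j)) else y)" if "j < pos y" for j
      using st that p(1,2) unfolding stacked_def by (cases "Suc j = pos y") auto
    moreover have "(if 0 < pos y then T (st 0) else y) = z"
      using st p(1,2) unfolding stacked_def by (auto split: if_splits)
    ultimately show ?thesis using st p unfolding stacked_def y[symmetric] by auto
  qed
  ultimately show ?thesis unfolding erase_inv_def y by blast
qed

lemma stacked_found:
  assumes st: "stacked cyc L z lam i h st pos pre" and y: "y = (if i < L then T (cyc i) else z)"
    and p: "pos y < h" "T (st (pos y)) = y" "pre h - pre (pos y) \<le> 0"
  shows "light_cycle st lam (pos y) h"
proof -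
  have inj: "inj_on (\<lambda>j. T (st j)) {pos y..<h}"
    using st unfolding stacked_def by (intro inj_on_inverseI[of _ pos]) auto
  have "(\<Sum>j=pos y..<h. w (st j) - lam) = (\<Sum>j=pos y..<h. pre (Suc j) - pre j)"
    using st unfolding stacked_def by (intro sum.cong) auto
  also have "\<dots> = pre h - pre (pos y)" using p(1) by (intro sum_Suc_diff') simp
  finally have "(\<Sum>j=pos y..<h. w (st j)) \<le> lam * (real h - real (pos y))"
    using p(1,3) by (simp add: sum_subtractf of_nat_diff algebra_simps)
  then show ?thesis
    using inj st p(1,2) unfolding light_cycle_def stacked_def y[symmetric] by simp
qed


section \<open>Correctness and running time of the program\<close>

text \<open>Whole arrays are compared, beyond the input cells too: the locale is later instantiated
  with the initial memory contents.\<close>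

definition inp :: "state \<Rightarrow> bool" where
  "inp s \<longleftrightarrow> nat_reg s ''n'' = n \<and> nat_reg s ''m'' = m \<and> real_reg s ''eps'' = eps \<and>
     nat_mem s ''tail'' = T \<and> nat_mem s ''head'' = H \<and> real_mem s ''w'' = w"

lemma inp_frame:
  assumes "frame c s s'" "inp s"
    and "''n'' \<notin> nregs c" "''m'' \<notin> nregs c" "''eps'' \<notin> rregs c" "''tail'' \<notin> nmems c" "''head'' \<notin> nmems c"
      "''w'' \<notin> rmems c"
  shows "inp s'"
  using assms by (simp add: inp_def frameD)

lemma wp_init_vertices:
  assumes "inp s"
  shows "wp init_vertices (\<lambda>t s'. t \<le> 5 * n + 2 \<and>
    (\<forall>u<n. nat_mem s' ''first'' u = 0 \<and> real_mem s' ''D'' u = 0 \<and> nat_mem s' ''start'' u = u)) s"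
  unfolding init_vertices_def wp_Seq wp_simps(2)
  by (rule wp_while[where I = "\<lambda>s. inp s \<and> nat_reg s ''v'' \<le> n \<and> (\<forall>u<nat_reg s ''v''.
      nat_mem s ''first'' u = 0 \<and> real_mem s ''D'' u = 0 \<and> nat_mem s ''start'' u = u)"
      and \<Phi> = "\<lambda>s. 5 * (n - nat_reg s ''v'')"])
    (use assms in \<open>auto simp: inp_def less_Suc_eq\<close>)

lemma wp_init_edges:
  assumes "inp s" and first: "\<And>u. u < n \<Longrightarrow> nat_mem s ''first'' u = 0"
  shows "wp init_edges (\<lambda>t s'. t \<le> 8 * m + 3 \<and> adj m (nat_mem s' ''first'') (nat_mem s' ''next'') \<and>
    0 \<le> real_reg s' ''wm'' \<and> real_reg s' ''wm'' \<le> wmax \<and>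
    (\<forall>e<m. \<bar>w e\<bar> \<le> real_reg s' ''wm'')) s"
  unfolding init_edges_def wp_Seq wp_simps(2,3)
proof (rule wp_while[where I = "\<lambda>s. inp s \<and> nat_reg s ''e'' \<le> m \<and>
      adj (nat_reg s ''e'') (nat_mem s ''first'') (nat_mem s ''next'') \<and>
      0 \<le> real_reg s ''wm'' \<and> real_reg s ''wm'' \<le> wmax \<and>
      (\<forall>e<nat_reg s ''e''. \<bar>w e\<bar> \<le> real_reg s ''wm'')"
      and \<Phi> = "\<lambda>s. 8 * (m - nat_reg s ''e'')"], goal_cases)
  case 1
  show ?case using assms adj_0[OF first] wmax_nonneg by (simp add: inp_def)
next
  case (2 s)
  then have "nat_reg s ''e'' < m" by (auto simp: inp_def)
  from adj_Suc[OF _ this, of "nat_mem s ''first''" "nat_mem s ''next''"] weight_le[OF this] 2 this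
  show ?case by (auto simp: inp_def less_Suc_eq abs_le_iff)
next
  case (3 t s)
  then show ?case by (auto simp: inp_def)
qed

lemma wp_relax:
  assumes "inp s" and b: "nat_reg s ''b'' = k * n"
    and lay: "layers (real_mem s ''D'') (nat_mem s ''start'') (nat_mem s ''pred'') k"
  shows "wp relax (\<lambda>t s'. t \<le> 9 * m + 3 \<and> nat_reg s' ''c'' = Suc k * n \<and>
     layers (real_mem s' ''D'') (nat_mem s' ''start'') (nat_mem s' ''pred'') (Suc k)) s"
  unfolding relax_def wp_Seq wp_simps(2)
proof (rule wp_while[where I = "\<lambda>s'. inp s' \<and> nat_reg s' ''e'' \<le> m \<and> nat_reg s' ''b'' = k * n \<and>
      nat_reg s' ''c'' = Suc k * n \<and>
      relax_inv (real_mem s ''D'') (nat_mem s ''start'') (nat_mem s ''pred'') k (nat_reg s' ''e'')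
        (real_mem s' ''D'') (nat_mem s' ''start'') (nat_mem s' ''pred'')"
      and \<Phi> = "\<lambda>s. 9 * (m - nat_reg s ''e'')"], goal_cases)
  case 1
  show ?case using assms relax_inv_0 by (simp add: inp_def)
next
  case (2 s')
  let ?e = "nat_reg s' ''e''"
  have e: "?e < m" using 2 by (simp add: inp_def)
  let ?v = "Suc k * n + H ?e" and ?D = "real_mem s' ''D''" and ?S = "nat_mem s' ''start''"
    and ?A = "nat_mem s' ''pred''"
  have inv: "relax_inv (real_mem s ''D'') (nat_mem s ''start'') (nat_mem s ''pred'') k ?e ?D ?S ?A"
    using 2 by blast
  show ?case
  proof (cases "?A ?v < ?e \<and> H (?A ?v) = H ?e \<and> ?D ?v \<le> ?D (k * n + T ?e) + w ?e")
    case True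
    then show ?thesis
      using 2 e relax_inv_skip[OF inv e] by (simp add: inp_def not_less)
  next
    case False
    note relax_inv_update[OF inv e this]
    moreover have "\<not> (?A ?v < ?e \<and> H (?A ?v) = H ?e \<and> \<not> ?D (k * n + T ?e) + w ?e < ?D ?v)"
      using False by (simp add: not_less)
    ultimately show ?thesis using 2 e by (auto simp: inp_def)
  qed
next
  case (3 t s')
  then have "nat_reg s' ''e'' = m" by (simp add: inp_def)
  then show ?case using 3 relax_inv_final[OF _ lay] by simp
qed

lemma wp_find_min:
  assumes "inp s" and c: "nat_reg s ''c'' = c"
  shows "wp find_min (\<lambda>t s'. t \<le> 4 * n + 3 \<and> nat_reg s' ''z'' < n \<and>
     (\<forall>v<n. real_mem s' ''D'' (c + nat_reg s' ''z'') \<le> real_mem s' ''D'' (c + v))) s"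
  unfolding find_min_def wp_Seq wp_simps(2)
proof (rule wp_while[where I = "\<lambda>s. inp s \<and> nat_reg s ''v'' \<le> n \<and> nat_reg s ''c'' = c \<and>
      nat_reg s ''z'' < n \<and>
      (\<forall>v<nat_reg s ''v''. real_mem s ''D'' (c + nat_reg s ''z'') \<le> real_mem s ''D'' (c + v))"
      and \<Phi> = "\<lambda>s. 4 * (n - nat_reg s ''v'')"], goal_cases)
  case 1
  then show ?case using assms n_pos by (simp add: inp_def)
next
  case (2 s)
  then show ?case
    by (cases "real_mem s ''D'' (c + nat_reg s ''v'') < real_mem s ''D'' (c + nat_reg s ''z'')")
      (fastforce simp: inp_def less_Suc_eq)+
next
  case (3 t s)
  then show ?case by (simp add: inp_def)
qed

lemma wp_bfs_loop:
  assumes "inp s" "adj m (nat_mem s ''first'') (nat_mem s ''next'')"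
    and "bfs_inv z (nat_mem s ''queue'') (nat_mem s ''pos'') (nat_mem s ''hops'') (real_mem s ''rhops'')
      (nat_mem s ''par'') (nat_reg s ''qh'') (nat_reg s ''qt'') (nat_reg s ''x'') (nat_reg s ''f'')"
  shows "wp bfs_loop (\<lambda>t s'. t \<le> 13 * m + 5 * n + 1 \<and> nat_mem s' ''hops'' z = 0 \<and>
     bfs_tree z (nat_mem s' ''hops'') (real_mem s' ''rhops'') (nat_mem s' ''par'')) s"
proof -
  let ?adj = "\<lambda>s. adj m (nat_mem s ''first'') (nat_mem s ''next'')"
  let ?inv = "\<lambda>s. bfs_inv z (nat_mem s ''queue'') (nat_mem s ''pos'') (nat_mem s ''hops'')
    (real_mem s ''rhops'') (nat_mem s ''par'') (nat_reg s ''qh'') (nat_reg s ''qt'') (nat_reg s ''x'') (nat_reg s ''f'')"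
  let ?left = "\<lambda>s. bfs_left (nat_mem s ''queue'') (nat_reg s ''qh'') (nat_reg s ''x'') (nat_reg s ''f'')"
  have left_le: "card (bfs_left q qh x f) \<le> m" for q qh x f
  proof -
    have "card (bfs_left q qh x f) \<le> card {..<m}"
      by (rule card_mono) (auto simp: bfs_left_def)
    then show ?thesis by simp
  qed
  show ?thesis
    unfolding bfs_loop_def
  \<comment> \<open>A turn that scans an edge is paid by an element of \<open>bfs_left\<close>, a
    turn that dequeues by the distance from \<open>qh\<close> to \<open>n\<close>.\<close>
  proof (rule wp_while[where I = "\<lambda>s. inp s \<and> ?adj s \<and> ?inv s"
        and \<Phi> = "\<lambda>s. 13 * card (?left s) + 5 * (n - nat_reg s ''qh'')"], goal_cases)
    case 1
    then show ?case using assms by simp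
  next
    case (2 s)
    let ?f = "nat_reg s ''f''" and ?q = "nat_mem s ''queue''" and ?qh = "nat_reg s ''qh''"
      and ?qt = "nat_reg s ''qt''" and ?x = "nat_reg s ''x''" and ?pos = "nat_mem s ''pos''"
    have inv: "?inv s" and adj: "?adj s" and inp: "inp s" using 2 by auto
    show ?case
    proof (cases "0 < ?f")
      case True
      let ?y = "H (?f - 1)" and ?f' = "nat_mem s ''next'' (?f - 1)"
      have fm: "?f \<le> m" "T (?f - 1) = ?x" using bfs_invD(5,6)[OF inv] True by auto
      have "?q (?qh - 1) \<in> ?q ` {..<?qh}" using bfs_invD(1)[OF inv] by simp
      then have "?x \<in> ?q ` {..<?qh}" using bfs_invD(4)[OF inv] by simp
      moreover have "?f' < ?f"
      proof -
        have "?f - 1 < m" using True fm(1) by linarith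
        then have "?f' \<le> ?f - 1" using adj unfolding adj_def by blast
        then show ?thesis using True by linarith
      qed
      ultimately have left: "Suc (card (bfs_left ?q ?qh ?x ?f')) \<le> card (bfs_left ?q ?qh ?x ?f)"
        using bfs_left_less[OF True fm] by blast
      show ?thesis
      proof (cases "?pos ?y < ?qt \<and> ?q (?pos ?y) = ?y")
        case vis: True
        then show ?thesis
          using bfs_inv_skip[OF inv True adj] True adj inp left by (simp add: inp_def)
      next
        case new: False
        have "bfs_left (?q(?qt := ?y)) ?qh ?x f = bfs_left ?q ?qh ?x f" for f
          using bfs_invD(2)[OF inv] unfolding bfs_left_def by auto
        then show ?thesis
          using bfs_inv_visit[OF inv True adj refl new] new True adj inp left by (auto simp: inp_def)
      qed
    next
      case False
      then have f: "?f = 0" and qt: "?qh < ?qt" using 2 by auto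
      note deq = bfs_inv_dequeue[OF inv[unfolded f] adj qt]
      have "card (bfs_left ?q (Suc ?qh) (?q ?qh) (nat_mem s ''first'' (?q ?qh))) \<le> card (bfs_left ?q ?qh ?x 0)"
        using deq(2) by (rule card_mono[rotated]) (simp add: bfs_left_def)
      moreover have "?qh < n" using qt bfs_inv_le[OF inv] by simp
      ultimately show ?thesis using deq(1) f adj inp by (simp add: inp_def)
    qed
  next
    case (3 t s')
    have inv: "?inv s'" using 3(1) by blast
    have f: "nat_reg s' ''f'' = 0" and qh: "nat_reg s' ''qh'' = nat_reg s' ''qt''"
      using 3(2) bfs_invD(2)[OF inv] by simp_all
    have "t \<le> 13 * m + 5 * n + 1"
      using 3(3) left_le[of "nat_mem s ''queue''" "nat_reg s ''qh''" "nat_reg s ''x''" "nat_reg s ''f''"]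
      by linarith
    then show ?case
      using bfs_inv_final[OF inv[unfolded f qh]] bfs_invD(7)[OF inv] by simp
  qed
qed

lemma wp_bfs:
  assumes "inp s" and adj: "adj m (nat_mem s ''first'') (nat_mem s ''next'')"
    and z: "nat_reg s ''z'' = z" "z < n"
  shows "wp bfs (\<lambda>t s'. t \<le> 13 * m + 5 * n + 9 \<and> nat_mem s' ''hops'' z = 0 \<and>
     bfs_tree z (nat_mem s' ''hops'') (real_mem s' ''rhops'') (nat_mem s' ''par'')) s"
  using assms bfs_inv_init[OF z(2) adj, of "nat_mem s ''queue''" "nat_mem s ''pos''"
          "nat_mem s ''hops''" "real_mem s ''rhops''" "nat_mem s ''par''"]
  by (simp add: bfs_def, intro wp_conseq[OF wp_bfs_loop[where z = z]]) (simp_all add: inp_def)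

lemma wp_trace_loop:
  fixes wm :: real
  assumes "inp s" and lay: "layers D S A K"
    and mem: "real_mem s ''D'' = D" "nat_mem s ''start'' = S" "nat_mem s ''pred'' = A"
      "nat_mem s ''hops'' = hops" "nat_mem s ''par'' = par"
    and tree: "bfs_tree z hops rhops par" "hops z = 0" and wm: "\<And>e. e < m \<Longrightarrow> \<bar>w e\<bar> \<le> wm"
    and "trace_inv D S K z u hops wm (nat_reg s ''b'') (nat_reg s ''i'') (nat_reg s ''x'')
      (real_reg s ''tot'') (real_reg s ''len'') (nat_mem s ''cyc'')"
  shows "wp trace_loop (\<lambda>t s'. t \<le> 9 * nat_reg s ''i'' + 1 \<and>
    trace_inv D S K z u hops wm (nat_reg s' ''b'') 0 (nat_reg s' ''x'')
      (real_reg s' ''tot'') (real_reg s' ''len'') (nat_mem s' ''cyc'')) s"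
  unfolding trace_loop_def
proof (rule wp_while[where I = "\<lambda>s. inp s \<and> real_mem s ''D'' = D \<and> nat_mem s ''start'' = S \<and>
      nat_mem s ''pred'' = A \<and> nat_mem s ''hops'' = hops \<and> nat_mem s ''par'' = par \<and>
      trace_inv D S K z u hops wm (nat_reg s ''b'') (nat_reg s ''i'') (nat_reg s ''x'')
        (real_reg s ''tot'') (real_reg s ''len'') (nat_mem s ''cyc'')"
      and \<Phi> = "\<lambda>s. 9 * nat_reg s ''i''"], goal_cases)
  case 1
  then show ?case using assms by simp
next
  case (2 s)
  let ?inv = "trace_inv D S K z u hops wm (nat_reg s ''b'') (nat_reg s ''i'') (nat_reg s ''x'')
        (real_reg s ''tot'') (real_reg s ''len'') (nat_mem s ''cyc'')"
  have inv: "?inv" and i: "0 < nat_reg s ''i''" using 2 by simp_all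
  show ?case
  proof (cases "0 < nat_reg s ''b''")
    case True
    then show ?thesis using trace_inv_walk[OF inv i True lay] 2 by (simp add: inp_def)
  next
    case False
    then have b: "nat_reg s ''b'' = 0" by simp
    show ?thesis using trace_inv_path[OF inv[unfolded b] i tree wm] b 2 by (simp add: inp_def)
  qed
next
  case (3 t s')
  then show ?case by simp
qed

lemma wp_trace:
  fixes wm :: real
  assumes inp: "inp s" and k: "nat_reg s ''k'' = K" "0 < K" "nat_reg s ''b'' = K * n"
    and lay: "layers (real_mem s ''D'') (nat_mem s ''start'') (nat_mem s ''pred'') K"
    and z: "nat_reg s ''z'' = z" "z < n" and u: "nat_reg s ''u'' = nat_mem s ''start'' (K * n + z)"
    and tree: "bfs_tree z (nat_mem s ''hops'') (real_mem s ''rhops'') (nat_mem s ''par'')"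
      "nat_mem s ''hops'' z = 0"
    and wm: "\<And>e. e < m \<Longrightarrow> \<bar>w e\<bar> \<le> wm"
    and L: "L = K + nat_mem s ''hops'' (nat_reg s ''u'')"
  shows "wp trace (\<lambda>t s'. t \<le> 9 * L + 6 \<and> closed_walk (nat_mem s' ''cyc'') L z \<and>
    real_reg s' ''lam'' = (\<Sum>j<L. w (nat_mem s' ''cyc'' j)) / real L \<and>
    real_reg s' ''lam'' * real L \<le>
      real_mem s ''D'' (K * n + z) + nat_mem s ''hops'' (nat_reg s ''u'') * wm) s"
proof -
  let ?u = "nat_reg s ''u''"
  define s0 where "s0 = s\<lparr>nat_reg := (nat_reg s)(''i'' := L, ''x'' := z),
    real_reg := (real_reg s)(''tot'' := 0, ''len'' := 0)\<rparr>"
  have loop: "wp trace_loop (\<lambda>t s'. t \<le> 9 * nat_reg s0 ''i'' + 1 \<and>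
      trace_inv (real_mem s ''D'') (nat_mem s ''start'') K z ?u (nat_mem s ''hops'') wm
        (nat_reg s' ''b'') 0 (nat_reg s' ''x'') (real_reg s' ''tot'') (real_reg s' ''len'')
        (nat_mem s' ''cyc'')) s0"
    by (rule wp_trace_loop[OF _ lay _ _ _ _ _ tree wm])
      (use inp k trace_inv_init[of K z ?u "nat_mem s ''start''" "real_mem s ''D''" "nat_mem s ''hops''"
          wm "nat_mem s ''cyc''"] z u in \<open>simp_all add: s0_def inp_def L\<close>)
  have "wp trace_loop (\<lambda>t s'. t + 5 \<le> 9 * L + 6 \<and> closed_walk (nat_mem s' ''cyc'') L z \<and>
    real_reg s' ''tot'' / real_reg s' ''len'' = (\<Sum>j<L. w (nat_mem s' ''cyc'' j)) / real L \<and>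
    real_reg s' ''tot'' / real_reg s' ''len'' * real L \<le>
      real_mem s ''D'' (K * n + z) + nat_mem s ''hops'' ?u * wm) s0"
  proof (rule wp_conseq[OF loop], goal_cases)
    case (1 t s')
    note fin = trace_inv_final[OF conjunct2[OF 1(1)] k(2) z(2) tree(1), folded L]
    have "0 < L" using k L by simp
    then show ?case using fin 1(1) by (simp add: s0_def)
  qed
  then show ?thesis
    unfolding trace_def using k z by (simp add: s0_def L)
qed

lemma wp_erase_loop:
  assumes "inp s" and walk: "closed_walk (nat_mem s ''cyc'') L z"
    and lam: "(\<Sum>j<L. w (nat_mem s ''cyc'' j) - real_reg s ''lam'') = 0"
    and init: "nat_reg s ''i'' = 0" "nat_reg s ''h'' = 0" "real_mem s ''pre'' 0 = 0" "real_reg s ''dif'' = 1"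
  shows "wp erase_loop (\<lambda>t s'. t \<le> 13 * L + 1 \<and> nat_reg s' ''h'' \<le> L \<and>
    light_cycle (nat_mem s' ''stack'') (real_reg s ''lam'') (nat_reg s' ''p'') (nat_reg s' ''h'')) s"
proof -
  define cyc lam where "cyc = nat_mem s ''cyc''" and "lam = real_reg s ''lam''"
  have L: "0 < L" using walk by (simp add: closed_walk_def)
  have sum0: "(\<Sum>j<L. w (cyc j) - lam) = 0" using assms(3) by (simp add: cyc_def lam_def)
  have walk: "closed_walk cyc L z" using walk by (simp add: cyc_def)
  show ?thesis
    unfolding erase_loop_def cyc_def[symmetric] lam_def[symmetric]
  proof (rule wp_while[where I = "\<lambda>s. inp s \<and> nat_mem s ''cyc'' = cyc \<and> real_reg s ''lam'' = lam \<and>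
      (if 0 < real_reg s ''dif'' then erase_inv cyc L z lam (nat_reg s ''i'') (nat_reg s ''h'')
         (nat_mem s ''stack'') (nat_mem s ''pos'') (real_mem s ''pre'')
       else nat_reg s ''h'' \<le> L \<and> light_cycle (nat_mem s ''stack'') lam (nat_reg s ''p'') (nat_reg s ''h''))"
      and \<Phi> = "\<lambda>s. 13 * (L - nat_reg s ''i'')"], goal_cases)
    case 1
    have "(real_mem s ''pre'')(0 := 0) = real_mem s ''pre''" using init(3) by auto
    then show ?case
      using assms erase_inv_init[OF walk, of lam "nat_mem s ''stack''" "nat_mem s ''pos''" "real_mem s ''pre''"]
      by (simp add: cyc_def lam_def)
  next
    case (2 s)
    let ?i = "nat_reg s ''i''" and ?h = "nat_reg s ''h''"
    have inv: "erase_inv cyc L z lam ?i ?h (nat_mem s ''stack'') (nat_mem s ''pos'') (real_mem s ''pre'')"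
      using 2 by simp
    have i: "?i < L" using erase_inv_less[OF inv L sum0] .
    define st pos pre where "st = (nat_mem s ''stack'')(?h := cyc ?i)"
      and "pos = (nat_mem s ''pos'')(T (cyc ?i) := ?h)"
      and "pre = (real_mem s ''pre'')(Suc ?h := real_mem s ''pre'' ?h + (w (cyc ?i) - lam))"
    define y where "y = H (cyc ?i)"
    have stk: "stacked cyc L z lam (Suc ?i) (Suc ?h) st pos pre"
      and y: "y = (if Suc ?i < L then T (cyc (Suc ?i)) else z)"
      using erase_push[OF inv walk i] by (simp_all add: st_def pos_def pre_def y_def)
    have hL: "Suc ?h \<le> L" using stk by (simp add: stacked_def)
    have push: "wp push (\<lambda>t s'. t = 7 \<and> inp s' \<and> nat_mem s' ''cyc'' = cyc \<and> real_reg s' ''lam'' = lam \<and>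
        nat_mem s' ''stack'' = st \<and> nat_mem s' ''pos'' = pos \<and> real_mem s' ''pre'' = pre \<and>
        nat_reg s' ''i'' = Suc ?i \<and> nat_reg s' ''h'' = Suc ?h \<and> nat_reg s' ''y'' = y \<and>
        0 < real_reg s' ''dif'') s"
      using 2 by (simp add: push_def inp_def st_def pos_def pre_def y_def)
    show ?case
      unfolding wp_Seq[of push]
    proof (rule wp_conseq[OF push], goal_cases)
      case (1 t s')
      show ?case
      proof (cases "pos y < Suc ?h \<and> T (st (pos y)) = y")
        case False
        then show ?thesis
          using stacked_new[OF stk y False] 1 i by (auto simp: inp_def)
      next
        case True
        then show ?thesis
          using stacked_pop[OF stk y] stacked_found[OF stk y] 1 i hL
          by (auto simp: inp_def)
      qed
    qed
  next
    case (3 t s')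
    then show ?case using init by simp
  qed
qed

lemma wp_erase:
  assumes "inp s" and walk: "closed_walk (nat_mem s ''cyc'') L z"
    and lam: "real_reg s ''lam'' = (\<Sum>j<L. w (nat_mem s ''cyc'' j)) / real L"
  shows "wp erase (\<lambda>t s'. t \<le> 13 * L + 5 \<and> nat_reg s' ''h'' \<le> L \<and>
    light_cycle (nat_mem s' ''stack'') (real_reg s ''lam'') (nat_reg s' ''p'') (nat_reg s' ''h'')) s"
proof -
  \<comment> \<open>\<open>lam\<close> is the mean of the closed walk, so the total excess over it
    vanishes.\<close>
  have "(\<Sum>j<L. w (nat_mem s ''cyc'' j) - real_reg s ''lam'') = 0"
    using walk unfolding lam by (simp add: sum_subtractf closed_walk_def)
  then show ?thesis
    using assms(1,2) unfolding erase_def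
    by (simp, intro wp_conseq[OF wp_erase_loop[where L = L and z = z]]) (simp_all add: inp_def)
qed

lemma wp_emit:
  assumes "inp s" and p: "nat_reg s ''p'' = p" "nat_reg s ''h'' = h" "nat_mem s ''stack'' = st" "p \<le> h"
  shows "wp emit (\<lambda>t s'. t \<le> 6 * (h - p) + 2 \<and>
    output_cycle s' = map (\<lambda>j. (T (st j), H (st j))) [p..<h]) s"
  unfolding emit_def wp_Seq wp_simps(2)
proof (rule wp_while[where I = "\<lambda>s. inp s \<and> nat_mem s ''stack'' = st \<and> nat_reg s ''h'' = h \<and>
      nat_reg s ''p'' = p + nat_reg s ''out_len'' \<and> nat_reg s ''p'' \<le> h \<and>
      (\<forall>j<nat_reg s ''out_len''. nat_mem s ''out_tail'' j = T (st (p + j)) \<and>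
        nat_mem s ''out_head'' j = H (st (p + j)))"
      and \<Phi> = "\<lambda>s. 6 * (h - nat_reg s ''p'')"], goal_cases)
  case 1
  then show ?case using assms by (simp add: inp_def)
next
  case (2 s)
  then show ?case by (auto simp: inp_def less_Suc_eq)
next
  case (3 t s')
  then have "nat_reg s' ''out_len'' = h - p" by auto
  moreover have "[p..<h] = map (\<lambda>j. j + p) [0..<h - p]"
    using \<open>p \<le> h\<close> by (simp add: map_add_upt)
  ultimately show ?case using 3 p(1) by (auto simp: output_cycle_def add.commute)
qed

lemma layers_start_less:
  assumes "layers D S A K"
  shows "k \<le> K \<Longrightarrow> v < n \<Longrightarrow> S (k * n + v) < n"
proof (induction k arbitrary: v)
  case 0
  then show ?case using assms by (simp add: layers_def)
next
  case (Suc k)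
  then have "A (Suc k * n + v) < m" "S (Suc k * n + v) = S (k * n + T (A (Suc k * n + v)))"
    using assms Suc_le_lessD unfolding layers_def by blast+
  then show ?case using Suc.IH[of "T (A (Suc k * n + v))"] Suc.prems tail_less by simp
qed

definition searched :: "real \<Rightarrow> nat \<Rightarrow> state \<Rightarrow> bool" where
  "searched wm k s \<longleftrightarrow> inp s \<and> adj m (nat_mem s ''first'') (nat_mem s ''next'') \<and>
     real_reg s ''wm'' = wm \<and> nat_reg s ''b'' = k * n \<and> nat_reg s ''k'' = k \<and>
     real_reg s ''rk'' = real k \<and>
     layers (real_mem s ''D'') (nat_mem s ''start'') (nat_mem s ''pred'') k \<and>
     (if k = 0 then real_reg s ''thr'' = 1
      else \<exists>z<n. nat_reg s ''z'' = z \<and>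
        (\<forall>v<n. real_mem s ''D'' (k * n + z) \<le> real_mem s ''D'' (k * n + v)) \<and>
        bfs_tree z (nat_mem s ''hops'') (real_mem s ''rhops'') (nat_mem s ''par'') \<and>
        nat_mem s ''hops'' z = 0 \<and> nat_reg s ''u'' = nat_mem s ''start'' (k * n + z) \<and>
        real_reg s ''thr'' = 8 * real (nat_mem s ''hops'' (nat_reg s ''u'')) * wm)"

lemma wp_search_round:
  assumes s: "searched wm k s"
  shows "wp search_round (\<lambda>t s'. t \<le> 51 * m \<and> searched wm (Suc k) s') s"
proof -
  have inp: "inp s" and adj: "adj m (nat_mem s ''first'') (nat_mem s ''next'')"
    and wm: "real_reg s ''wm'' = wm" and b: "nat_reg s ''b'' = k * n" and k: "nat_reg s ''k'' = k"
    and rk: "real_reg s ''rk'' = real k"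
    and lay: "layers (real_mem s ''D'') (nat_mem s ''start'') (nat_mem s ''pred'') k"
    using s unfolding searched_def by blast+
  show ?thesis
    unfolding search_round_def wp_Seq
  proof (rule wp_conseq[OF wp_relax[OF inp b lay]], goal_cases)
    case (1 t1 s1)
    note fr = frameD[OF 1(2)]
    have inp1: "inp s1" by (rule inp_frame[OF 1(2) inp]) (simp_all add: relax_def)
    have s1: "nat_mem s1 ''first'' = nat_mem s ''first''" "nat_mem s1 ''next'' = nat_mem s ''next''"
      "real_reg s1 ''wm'' = wm" "nat_reg s1 ''k'' = k" "real_reg s1 ''rk'' = real k"
      using wm k rk by (simp_all add: fr relax_def)
    have c1: "nat_reg s1 ''c'' = Suc k * n" using 1 by blast
    show ?case
    proof (rule wp_conseq[OF wp_find_min[OF inp1 c1]], goal_cases)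
      case A: (1 t2 s2)
      note fr = frameD[OF A(2)]
      have inp2: "inp s2" by (rule inp_frame[OF A(2) inp1]) (simp_all add: find_min_def)
      have s2: "nat_mem s2 ''first'' = nat_mem s ''first''" "nat_mem s2 ''next'' = nat_mem s ''next''"
        "real_reg s2 ''wm'' = wm" "nat_reg s2 ''k'' = k" "real_reg s2 ''rk'' = real k"
        "nat_reg s2 ''c'' = Suc k * n" "real_mem s2 ''D'' = real_mem s1 ''D''"
        "nat_mem s2 ''start'' = nat_mem s1 ''start''" "nat_mem s2 ''pred'' = nat_mem s1 ''pred''"
        using s1 c1 by (simp_all add: fr find_min_def)
      have adj2: "adj m (nat_mem s2 ''first'') (nat_mem s2 ''next'')" using adj s2 by simp
      have z: "nat_reg s2 ''z'' < n" using A by blast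
      show ?case
      proof (rule wp_conseq[OF wp_bfs[OF inp2 adj2 refl z]], goal_cases)
        case B: (1 t3 s3)
        note fr = frameD[OF B(2)]
        have inp3: "inp s3" by (rule inp_frame[OF B(2) inp2]) (simp_all add: bfs_def bfs_loop_def)
        have s3: "nat_mem s3 ''first'' = nat_mem s ''first''" "nat_mem s3 ''next'' = nat_mem s ''next''"
          "real_reg s3 ''wm'' = wm" "nat_reg s3 ''k'' = k" "real_reg s3 ''rk'' = real k"
          "nat_reg s3 ''c'' = Suc k * n" "real_mem s3 ''D'' = real_mem s1 ''D''"
          "nat_mem s3 ''start'' = nat_mem s1 ''start''" "nat_mem s3 ''pred'' = nat_mem s1 ''pred''"
          "nat_reg s3 ''z'' = nat_reg s2 ''z''"
          using s2 by (simp_all add: fr bfs_def bfs_loop_def)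
        have lay3: "layers (real_mem s3 ''D'') (nat_mem s3 ''start'') (nat_mem s3 ''pred'') (Suc k)"
          using 1 s3 by simp
        define z where "z = nat_reg s2 ''z''"
        define u where "u = nat_mem s3 ''start'' (Suc k * n + z)"
        have "u < n" unfolding u_def by (rule layers_start_less[OF lay3]) (use z z_def in simp_all)
        then have ru: "real_mem s3 ''rhops'' u = real (nat_mem s3 ''hops'' u)"
          using B(1) unfolding bfs_tree_def by blast
        \<comment> \<open>The parts cost at most \<open>22 * m + 9 * n + 20\<close>, where
          \<open>0 < n\<close> and \<open>n \<le> m\<close>.\<close>
        have "t1 + (t2 + t3) + 5 \<le> 51 * m"
          using 1 A B n_le_m n_pos by linarith
        then show ?case
          using A(1) B(1) inp3 s2(7) s3 lay3 adj z ru[unfolded u_def]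
          by (simp add: searched_def inp_def z_def[symmetric])
      qed
    qed
  qed
qed

text \<open>From the first round on the threshold is at most \<open>8 * d * wmax\<close>, as
  \<open>hops\<close> is bounded by \<open>d\<close> and \<open>wm\<close> by \<open>wmax\<close>.
  While the search continues, \<open>k\<close> is therefore below
  \<open>8 * d * wmax / eps\<close>.\<close>

lemma wp_search:
  assumes inp: "inp s" and adj: "adj m (nat_mem s ''first'') (nat_mem s ''next'')"
    and lay: "\<And>u. u < n \<Longrightarrow> real_mem s ''D'' u = 0 \<and> nat_mem s ''start'' u = u"
    and wm: "real_reg s ''wm'' = wm" "0 \<le> wm" "wm \<le> wmax"
    and B: "real B \<ge> 8 * real d * wmax / eps + 1"
  shows "wp search (\<lambda>t s'. \<exists>K. 0 < K \<and> K \<le> B \<and> t \<le> (51 * m + 1) * B + 5 \<and> searched wm K s' \<and>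
    8 * real (nat_mem s' ''hops'' (nat_reg s' ''u'')) * wm \<le> eps * K) s"
proof -
  have start: "searched wm 0 (s\<lparr>nat_reg := (nat_reg s)(''b'' := 0, ''k'' := 0),
      real_reg := (real_reg s)(''rk'' := 0, ''thr'' := 1)\<rparr>)" (is "searched wm 0 ?s")
    using assms by (simp add: searched_def inp_def layers_def)
  have thr: "real_reg s' ''thr'' \<le> 8 * real d * wmax" if "searched wm k s'" "k \<noteq> 0" for k s'
  proof -
    from that obtain z where z: "z < n" "nat_reg s' ''u'' = nat_mem s' ''start'' (k * n + z)"
      "bfs_tree z (nat_mem s' ''hops'') (real_mem s' ''rhops'') (nat_mem s' ''par'')"
      "real_reg s' ''thr'' = 8 * real (nat_mem s' ''hops'' (nat_reg s' ''u'')) * wm"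
      unfolding searched_def by auto
    have "nat_reg s' ''u'' < n"
      unfolding z(2) using layers_start_less[of _ _ _ k] z(1) that(1) unfolding searched_def by blast
    then have "nat_mem s' ''hops'' (nat_reg s' ''u'') \<le> d" using z(3) unfolding bfs_tree_def by blast
    then show ?thesis unfolding z(4) using wm by (intro mult_mono) auto
  qed
  have loop: "wp search_loop (\<lambda>t s'. \<exists>K. 0 < K \<and> K \<le> B \<and> t \<le> (51 * m + 1) * B + 1 \<and> searched wm K s' \<and>
    8 * real (nat_mem s' ''hops'' (nat_reg s' ''u'')) * wm \<le> eps * K) ?s"
    unfolding search_loop_def
  proof (rule wp_while[where I = "\<lambda>s. searched wm (nat_reg s ''k'') s \<and> nat_reg s ''k'' \<le> B"
        and \<Phi> = "\<lambda>s. (51 * m + 1) * (B - nat_reg s ''k'')"], goal_cases)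
    case 1
    show ?case using start by simp
  next
    case (2 s')
    let ?k = "nat_reg s' ''k''"
    have s': "searched wm ?k s'" using 2 by simp
    have lt: "eps * real ?k < real_reg s' ''thr''" using 2 by (simp add: searched_def inp_def)
    have "?k < B"
    proof (cases "?k = 0")
      case True
      have "0 \<le> 8 * real d * wmax / eps" using wmax_nonneg eps_pos by simp
      then have "0 < real B" using B by linarith
      then show ?thesis using True by simp
    next
      case False
      then have "real ?k < 8 * real d * wmax / eps"
        using lt thr[OF s'] eps_pos by (simp add: field_simps)
      then show ?thesis using B by linarith
    qed
    then obtain r where r: "B = Suc (?k + r)" using less_imp_Suc_add by blast
    show ?case
      by (rule wp_conseq[OF wp_search_round[OF s']]) (use r in \<open>auto simp: searched_def\<close>)
  next
    case (3 t s')
    let ?k = "nat_reg s' ''k''"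
    have s': "searched wm ?k s'" using 3 by simp
    have ge: "real_reg s' ''thr'' \<le> eps * real ?k" using 3 by (simp add: searched_def inp_def)
    \<comment> \<open>The initial threshold 1 exceeds \<open>eps * 0\<close>, so the loop cannot
      stop before its first round.\<close>
    have "?k \<noteq> 0"
    proof
      assume "?k = 0"
      then have "real_reg s' ''thr'' = 1" using s' by (simp add: searched_def)
      then show False using ge \<open>?k = 0\<close> by simp
    qed
    then show ?case using 3 ge by (intro exI[of _ ?k]) (simp add: searched_def)
  qed
  show ?thesis
    unfolding search_def
    by simp (rule wp_conseq[OF loop], auto)
qed

lemma wp_approx_min_mean_cycle:
  fixes p :: "nat \<Rightarrow> real"
  assumes inp: "inp s" and p: "\<And>e. e < m \<Longrightarrow> 0 \<le> p e" "(\<Sum>e<m. p e) = 1"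
    and B: "real B \<ge> 8 * real d * wmax / eps + 1"
  defines "F \<equiv> \<Sum>e<m. p e * w e"
    and "\<delta> \<equiv> \<Sum>v<n. \<bar>(\<Sum>e\<in>{e\<in>{..<m}. T e = v}. p e) - (\<Sum>e\<in>{e\<in>{..<m}. H e = v}. p e)\<bar>"
  shows "wp approx_min_mean_cycle (\<lambda>t s'. t \<le> 200 * m * B \<and>
    (\<exists>st lam a b. light_cycle st lam a b \<and> lam \<le> F + eps / 4 + 2 * d * wmax * \<delta> \<and>
      output_cycle s' = map (\<lambda>j. (T (st j), H (st j))) [a..<b])) s"
proof -
  have m: "0 < m" using n_le_m n_pos by simp
  have "0 \<le> 8 * real d * wmax / eps" using wmax_nonneg eps_pos by simp
  then have B0: "0 < B" using B by (cases B) auto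
  show ?thesis
    unfolding approx_min_mean_cycle_def wp_Seq
  proof (rule wp_conseq[OF wp_init_vertices[OF inp]], goal_cases)
    case (1 t1 s1)
    have t1: "t1 \<le> 5 * m + 2" using 1(1) n_le_m by linarith
    have inp1: "inp s1" by (rule inp_frame[OF 1(2) inp]) (simp_all add: init_vertices_def)
    have first1: "nat_mem s1 ''first'' u = 0" if "u < n" for u using 1 that by blast
    show ?case
    proof (rule wp_conseq[OF wp_init_edges[OF inp1 first1]], goal_cases)
      case (2 t2 s2)
      have t2: "t2 \<le> 8 * m + 3" using 2(1) by blast
      note fr2 = frameD[OF 2(2)]
      have inp2: "inp s2" by (rule inp_frame[OF 2(2) inp1]) (simp_all add: init_edges_def)
      have lay2: "real_mem s2 ''D'' u = 0 \<and> nat_mem s2 ''start'' u = u" if "u < n" for u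
        using 1 that by (simp add: fr2 init_edges_def)
      define wm where "wm = real_reg s2 ''wm''"
      have wm: "0 \<le> wm" "wm \<le> wmax" and wme: "\<And>e. e < m \<Longrightarrow> \<bar>w e\<bar> \<le> wm"
        using 2(1) by (auto simp: wm_def)
      have adj2: "adj m (nat_mem s2 ''first'') (nat_mem s2 ''next'')" using 2(1) by blast
      show ?case
      proof (rule wp_conseq[OF wp_search[OF inp2 adj2 lay2 wm_def[symmetric] wm B]], goal_cases)
        case (2 t3 s3)
        then obtain K where K: "0 < K" "K \<le> B" "t3 \<le> (51 * m + 1) * B + 5" "searched wm K s3"
          and stop: "8 * real (nat_mem s3 ''hops'' (nat_reg s3 ''u'')) * wm \<le> eps * K" by blast
        define z u l L where "z = nat_reg s3 ''z''" and "u = nat_reg s3 ''u''"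
          and "l = nat_mem s3 ''hops'' u" and "L = K + l"
        have s3: "inp s3" "nat_reg s3 ''k'' = K" "nat_reg s3 ''b'' = K * n"
          "layers (real_mem s3 ''D'') (nat_mem s3 ''start'') (nat_mem s3 ''pred'') K"
          "z < n" "\<And>v. v < n \<Longrightarrow> real_mem s3 ''D'' (K * n + z) \<le> real_mem s3 ''D'' (K * n + v)"
          "bfs_tree z (nat_mem s3 ''hops'') (real_mem s3 ''rhops'') (nat_mem s3 ''par'')"
          "nat_mem s3 ''hops'' z = 0" "nat_reg s3 ''u'' = nat_mem s3 ''start'' (K * n + z)"
          using K(1,4) by (auto simp: searched_def z_def)
        have "u < n" unfolding u_def s3(9) by (rule layers_start_less[OF s3(4) order_refl s3(5)])
        then have "l \<le> d" using s3(7) unfolding bfs_tree_def l_def by blast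
        then have l: "l \<le> m" using diam_le n_le_m by linarith
        show ?case
        proof (rule wp_conseq[OF wp_trace[OF s3(1,2) K(1) s3(3,4) z_def[symmetric] s3(5,9,7,8) wme
              L_def[unfolded l_def u_def]]], goal_cases)
          case (2 t4 s4)
          have t4: "t4 \<le> 9 * L + 6" using 2(1) by blast
          have inp4: "inp s4" by (rule inp_frame[OF 2(2) s3(1)]) (simp_all add: trace_def trace_loop_def)
          have walk: "closed_walk (nat_mem s4 ''cyc'') L z" and
            lam: "real_reg s4 ''lam'' = (\<Sum>j<L. w (nat_mem s4 ''cyc'' j)) / real L" and
            le: "real_reg s4 ''lam'' * real L \<le> real_mem s3 ''D'' (K * n + z) + l * wm"
            using 2(1) by (auto simp: l_def u_def)
          define lam where "lam = real_reg s4 ''lam''"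
          have L0: "0 < real L" using K(1) by (simp add: L_def)
          define E where "E = 2 * d * wmax * \<delta>"
          have E0: "0 \<le> E"
            unfolding E_def \<delta>_def using wmax_nonneg by (intro mult_nonneg_nonneg sum_nonneg) auto
          \<comment> \<open>An average of edge weights is at least \<open>- wm\<close>. Hence
            counting the \<open>l\<close> closing edges at \<open>F + E\<close> instead of at their
            bound \<open>wm\<close> loses at most \<open>2 * l * wm\<close>.\<close>
          have Fwm: "- wm \<le> F"
          proof -
            have "(\<Sum>e<m. p e * - wm) \<le> F"
              unfolding F_def using p(1) wme by (intro sum_mono mult_left_mono) (fastforce simp: abs_le_iff)+
            then show ?thesis using p(2) by (simp add: sum_negf sum_distrib_right[symmetric])
          qed
          have "lam * real L \<le> real K * (F + E) + real l * wm"
            using le layers_min_le_flow[OF s3(4) p s3(5,6)]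
            unfolding lam_def F_def E_def \<delta>_def by linarith
          also have "\<dots> = real L * (F + E) - real l * (F + E) + real l * wm"
            by (simp add: L_def algebra_simps)
          also have "\<dots> \<le> real L * (F + E) + 2 * (real l * wm)"
          proof -
            have "real l * (- wm) \<le> real l * (F + E)"
              using Fwm E0 by (intro mult_left_mono) auto
            then show ?thesis unfolding mult_minus_right by linarith
          qed
          \<comment> \<open>The stopping test bounds \<open>8 * l * wm\<close> by
            \<open>eps * K\<close>, and \<open>K\<close> is at most \<open>L\<close>.\<close>
          also have "\<dots> \<le> real L * (F + E) + real L * (eps / 4)"
          proof -
            have "eps * real K \<le> eps * real L" using eps_pos by (simp add: L_def)
            then show ?thesis using stop by (simp add: l_def u_def algebra_simps)
          qed
          finally have "real L * lam \<le> real L * (F + E + eps / 4)" by (simp add: algebra_simps)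
          then have lam_le: "lam \<le> F + eps / 4 + E" using L0 by simp
          show ?case
          proof (rule wp_conseq[OF wp_erase[OF inp4 walk lam]], goal_cases)
            case (1 t5 s5)
            have t5: "t5 \<le> 13 * L + 5" using 1(1) by blast
            have inp5: "inp s5"
              by (rule inp_frame[OF 1(2) inp4]) (simp_all add: erase_def erase_loop_def push_def)
            have light: "light_cycle (nat_mem s5 ''stack'') lam (nat_reg s5 ''p'') (nat_reg s5 ''h'')"
              and hL: "nat_reg s5 ''h'' \<le> L" using 1 by (auto simp: lam_def)
            then have ph: "nat_reg s5 ''p'' \<le> nat_reg s5 ''h''" by (simp add: light_cycle_def)
            show ?case
            proof (rule wp_conseq[OF wp_emit[OF inp5 refl refl refl ph]], goal_cases)
              case (1 t6 s6)
              \<comment> \<open>All costs are expressed through \<open>m * B\<close>; in particular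
                the closed walk has at most \<open>2 * m * B\<close> edges.\<close>
              have "m * K \<le> m * B" "L \<le> m * K + m" "m \<le> m * B" "B \<le> m * B" "1 \<le> m * B"
                using K(1,2) l m B0 by (simp_all add: L_def add_mono Suc_leI)
              moreover have "t6 \<le> 6 * L + 2" using 1(1) hL by linarith
              moreover have "t3 \<le> 51 * (m * B) + B + 5" using K(3) by (simp add: algebra_simps)
              moreover note t1 t2 t4 t5
              ultimately have "t1 + (t2 + (t3 + (t4 + (t5 + t6)))) \<le> 200 * (m * B)" by linarith
              then show ?case
                using 1(1) light lam_le E_def by (auto simp: mult.assoc)
            qed
          qed
        qed
      qed
    qed
  qed
qed

end


section \<open>Digraphs given by edge lists\<close>

lemma (in wf_digraph) awalk_imp_relpow:
  "awalk u p v \<Longrightarrow> (u, v) \<in> ((\<lambda>e. (tail G e, head G e)) ` arcs G) ^^ length p"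
proof (induction p arbitrary: u)
  case (Cons a p)
  then have "(u, head G a) \<in> (\<lambda>e. (tail G e, head G e)) ` arcs G"
    "(head G a, v) \<in> ((\<lambda>e. (tail G e, head G e)) ` arcs G) ^^ length p"
    by (auto simp: awalk_Cons_iff)
  then show ?case by (simp only: list.size(4) add_Suc_right add_0_right) (rule relpow_Suc_I2)
qed (simp add: awalk_Nil_iff)

lemma diameter_relpow:
  assumes G: "pair_fin_digraph G" and sc: "strongly_connected (with_proj G)"
    and u: "u \<in> pverts G" and v: "v \<in> pverts G"
  shows "\<exists>k\<le>diameter G. (u, v) \<in> parcs G ^^ k" and "diameter G \<le> card (pverts G)"
proof -
  interpret pair_fin_digraph G by fact
  have hop: "\<exists>p. apath a p b \<and> length p = hop_distance G a b" if "a \<in> pverts G" "b \<in> pverts G" for a b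
  proof -
    have "\<exists>p. apath a p b"
      using sc that by (auto simp: strongly_connected_def reachable_awalk intro: apath_awalk_to_apath)
    then show ?thesis
      unfolding hop_distance_def using LeastI_ex[of "\<lambda>k. \<exists>p. apath a p b \<and> length p = k"] by blast
  qed
  let ?X = "{hop_distance G u v |u v. u \<in> pverts G \<and> v \<in> pverts G}"
  have fin: "finite ?X"
    using finite_image_set2[of "\<lambda>u. u \<in> pverts G" "\<lambda>v. v \<in> pverts G"] pair_finite_verts by simp
  have "hop_distance G u v \<le> diameter G"
    unfolding diameter_def by (rule Max_ge[OF fin]) (use u v in blast)
  moreover obtain p where "apath u p v" "length p = hop_distance G u v" using hop u v by blast
  ultimately show "\<exists>k\<le>diameter G. (u, v) \<in> parcs G ^^ k"
    using awalk_imp_relpow[of u p v] by (auto simp: apath_def)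
  have "diameter G \<in> ?X" unfolding diameter_def by (rule Max_in[OF fin]) (use u v in blast)
  then obtain a b where "diameter G = hop_distance G a b" "a \<in> pverts G" "b \<in> pverts G" by blast
  \<comment> \<open>The diameter is attained by a path without repeated vertices, which has fewer
    edges than there are vertices.\<close>
  then show "diameter G \<le> card (pverts G)"
    using hop[of a b] length_apath_less by fastforce
qed

lemma (in wf_digraph) cycleI:
  fixes e :: "nat \<Rightarrow> 'b"
  assumes "a < b" and arc: "\<And>j. a \<le> j \<Longrightarrow> j < b \<Longrightarrow> e j \<in> arcs G"
    and inj: "inj_on (\<lambda>j. tail G (e j)) {a..<b}"
    and head: "\<And>j. a \<le> j \<Longrightarrow> j < b \<Longrightarrow>
      head G (e j) = (if Suc j < b then tail G (e (Suc j)) else tail G (e a))"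
  shows "cycle (map e [a..<b])"
proof -
  let ?u = "tail G (e a)" and ?p = "map e [a..<b]"
  have ne: "?p \<noteq> []" and upt: "[a..<b] = a # [Suc a..<b]"
    using \<open>a < b\<close> by (simp_all add: upt_conv_Cons)
  have "cas (if c < b then tail G (e c) else ?u) (map e [c..<b]) ?u" if "a \<le> c" "c \<le> b" for c
    using \<open>c \<le> b\<close> \<open>a \<le> c\<close>
  proof (induction c rule: inc_induct)
    case (step c)
    then show ?case using head[of c] by (simp add: upt_conv_Cons)
  qed simp
  from this[of a] have "cas ?u ?p ?u" using \<open>a < b\<close> by simp
  moreover have "set ?p \<subseteq> arcs G" using arc by auto
  moreover have "?u \<in> verts G" using arc[of a] \<open>a < b\<close> by simp
  ultimately have "awalk ?u ?p ?u" by (simp add: awalk_def)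
  moreover have "distinct (tl (awalk_verts ?u ?p))"
  proof -
    have rotate: "distinct (tl xs @ [hd xs])" if "distinct xs" "xs \<noteq> []" for xs :: "'a list"
      using that by (cases xs) auto
    have "last ?p = e (b - 1)" using \<open>a < b\<close> by (simp add: last_map)
    then have last: "head G (last ?p) = ?u" using head[of "b - 1"] \<open>a < b\<close> by simp
    have "hd (map (tail G) ?p) = ?u" unfolding upt by simp
    \<comment> \<open>The vertices of the walk are its tails followed by the final head, which
      equals the first tail. Dropping the first vertex thus rotates the list of tails.\<close>
    then have "tl (awalk_verts ?u ?p) = tl (map (tail G) ?p) @ [hd (map (tail G) ?p)]"
      unfolding awalk_verts_conv last using ne by simp
    moreover have "distinct (map (tail G) ?p)"
      using inj by (simp add: distinct_map comp_def)
    then have "distinct (tl (map (tail G) ?p) @ [hd (map (tail G) ?p)])"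
      by (rule rotate) (use ne in simp)
    ultimately show ?thesis by simp
  qed
  ultimately show ?thesis unfolding cycle_def using ne by blast
qed

text \<open>Taking \<open>g\<close> constant or an indicator of one endpoint gives the total mass
  and the row and column sums of the flow in terms of edge numbers.\<close>

lemma sum_flow_nth:
  fixes P :: "nat \<Rightarrow> nat \<Rightarrow> real"
  assumes G: "pair_fin_digraph G" and P: "P \<in> normalized_flows G"
    and es: "distinct es" "set es = parcs G"
  shows "(\<Sum>i\<in>pverts G. \<Sum>j\<in>pverts G. P i j * g i j) =
    (\<Sum>k<length es. P (fst (es ! k)) (snd (es ! k)) * g (fst (es ! k)) (snd (es ! k)))"
proof -
  interpret pair_fin_digraph G by fact
  have sub: "parcs G \<subseteq> pverts G \<times> pverts G" using in_arcsD1 in_arcsD2 by auto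
  have "(\<Sum>i\<in>pverts G. \<Sum>j\<in>pverts G. P i j * g i j) =
      (\<Sum>e\<in>pverts G \<times> pverts G. P (fst e) (snd e) * g (fst e) (snd e))"
    by (simp add: sum.cartesian_product case_prod_beta)
  also have "\<dots> = (\<Sum>e\<in>parcs G. P (fst e) (snd e) * g (fst e) (snd e))"
  proof (rule sum.mono_neutral_right)
    show "\<forall>e\<in>pverts G \<times> pverts G - parcs G. P (fst e) (snd e) * g (fst e) (snd e) = 0"
      using P unfolding normalized_flows_def by fastforce
  qed (use sub pair_finite_verts in auto)
  also have "\<dots> = (\<Sum>k<length es. P (fst (es ! k)) (snd (es ! k)) * g (fst (es ! k)) (snd (es ! k)))"
    using sum.reindex_bij_betw[OF bij_betw_nth[OF es(1) refl es(2)[symmetric]],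
        of "\<lambda>e. P (fst e) (snd e) * g (fst e) (snd e)"] by simp
  finally show ?thesis .
qed

lemma approx_min_mean_cycle_correct:
  fixes G :: "nat pair_pre_digraph"
  assumes G: "pair_fin_digraph G" and V: "pverts G = {..<n}"
    and sc: "strongly_connected (with_proj G)" and d: "d = diameter G"
    and weight: "\<And>e. e \<in> parcs G \<Longrightarrow> w e \<in> {- wmax..wmax}"
    and P: "P \<in> normalized_flows G" and eps: "0 < \<epsilon>"
    and es: "distinct es" "set es = parcs G" and s: "input_loaded n es w P \<epsilon> s"
    and B: "8 * real d * wmax / \<epsilon> + 1 \<le> real B"
  shows "0 \<le> wmax" and "\<exists>t s'. exec approx_min_mean_cycle s t s' \<and> t \<le> 200 * card (parcs G) * B \<and>
    pre_digraph.cycle (with_proj G) (output_cycle s') \<and>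
    mean_weight w (output_cycle s') \<le>
      flow_cost G P w + \<epsilon> / 4 + 2 * real d * wmax * imbalance G P"
proof -
  interpret pair_fin_digraph G by fact
  define m where "m = length es"
  define T H where "T = nat_mem s ''tail''" and "H = nat_mem s ''head''"
  define p where "p k = P (T k) (H k)" for k
  have m: "m = card (parcs G)" using distinct_card[OF es(1)] es(2) by (simp add: m_def)
  have TH: "es ! k = (T k, H k)" "(T k, H k) \<in> parcs G" "real_mem s ''w'' k = w (T k, H k)" if "k < m" for k
  proof -
    show "es ! k = (T k, H k)"
      using s that by (simp add: input_loaded_def T_def H_def m_def)
    then show "(T k, H k) \<in> parcs G" using nth_mem[of k es] that es(2) by (simp add: m_def)
    show "real_mem s ''w'' k = w (T k, H k)"
      using s that \<open>es ! k = (T k, H k)\<close> by (simp add: input_loaded_def m_def)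
  qed
  have parcs: "(\<lambda>e. (T e, H e)) ` {..<m} = parcs G"
  proof -
    have "parcs G = (\<lambda>k. es ! k) ` {..<m}" using es(2) by (auto simp: set_conv_nth m_def)
    also have "\<dots> = (\<lambda>e. (T e, H e)) ` {..<m}" using TH(1) by (intro image_cong) auto
    finally show ?thesis by simp
  qed
  have flow: "(\<Sum>i<n. \<Sum>j<n. P i j * g i j) = (\<Sum>k<m. p k * g (T k) (H k))" for g
    using sum_flow_nth[OF G P es, of g] TH(1) unfolding V m_def[symmetric] by (simp add: p_def)
  have p_sum: "(\<Sum>k<m. p k) = 1"
    using flow[of "\<lambda>_ _. 1"] P by (simp add: normalized_flows_def V)
  \<comment> \<open>Total mass 1 forces an edge to exist, even on a single vertex.\<close>
  have m0: "0 < m" using p_sum by (cases m) auto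
  have T_less: "T k < n" and H_less: "H k < n" if "k < m" for k
    using in_arcsD1[OF TH(2)[OF that]] in_arcsD2[OF TH(2)[OF that]] V by auto
  have p_nonneg: "0 \<le> p k" if "k < m" for k
    using P T_less[OF that] H_less[OF that] by (auto simp: normalized_flows_def V p_def)
  have n0: "0 < n" using T_less[OF m0] by simp
  note diam = diameter_relpow[OF G sc, folded d, unfolded V]
  have in_arc: "\<exists>e<m. H e = v" if v: "v < n" for v
  proof -
    \<comment> \<open>A walk from the head of edge 0 to \<open>v\<close> either ends with an edge
      into \<open>v\<close> or is empty, and then edge 0 itself enters \<open>v\<close>.\<close>
    obtain k where k: "(H 0, v) \<in> parcs G ^^ k" using diam(1)[of "H 0" v] H_less[OF m0] v by auto
    show ?thesis
    proof (cases k)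
      case 0
      then show ?thesis using k m0 by auto
    next
      case (Suc j)
      then obtain a where "(a, v) \<in> parcs G" using k by auto
      then show ?thesis unfolding parcs[symmetric] by auto
    qed
  qed
  interpret idx: indexed_digraph n m d T H "real_mem s ''w''" \<epsilon> wmax
  proof
    show "\<exists>k\<le>d. (u, v) \<in> (\<lambda>e. (T e, H e)) ` {..<m} ^^ k" if "u < n" "v < n" for u v
      using diam(1)[of u v] that unfolding parcs by simp
    show "d \<le> n" using diam(2)[of 0 0] n0 by simp
    show "\<bar>real_mem s ''w'' e\<bar> \<le> wmax" if "e < m" for e
      using weight[OF TH(2)[OF that]] TH(3)[OF that] by (auto simp: abs_le_iff)
  qed (fact T_less H_less in_arc n0 eps)+
  show "0 \<le> wmax" by (rule idx.wmax_nonneg)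
  have inp: "idx.inp s" unfolding idx.inp_def using s by (simp add: input_loaded_def T_def H_def m_def)
  have cost: "(\<Sum>k<m. p k * real_mem s ''w'' k) = flow_cost G P w"
  proof -
    have "flow_cost G P w = (\<Sum>k<m. case es ! k of (i, j) \<Rightarrow> P i j * w (i, j))"
      unfolding flow_cost_def m_def
      by (rule sum.reindex_bij_betw[OF bij_betw_nth[OF es(1) refl es(2)[symmetric]], symmetric])
    also have "\<dots> = (\<Sum>k<m. p k * real_mem s ''w'' k)"
      using TH by (intro sum.cong) (auto simp: p_def)
    finally show ?thesis by simp
  qed
  have imb: "(\<Sum>v<n. \<bar>(\<Sum>e\<in>{e\<in>{..<m}. T e = v}. p e) - (\<Sum>e\<in>{e\<in>{..<m}. H e = v}. p e)\<bar>) = imbalance G P"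
    unfolding imbalance_def V
  proof (intro sum.cong refl)
    fix v assume v: "v \<in> {..<n}"
    have "(\<Sum>e\<in>{e\<in>{..<m}. T e = v}. p e) = (\<Sum>k<m. if T k = v then p k else 0)"
      by (rule sum.inter_filter) simp
    also have "\<dots> = (\<Sum>k<m. p k * of_bool (T k = v))" by (intro sum.cong) auto
    also have "\<dots> = (\<Sum>i<n. \<Sum>j<n. P i j * of_bool (i = v))" by (rule flow[symmetric])
    also have "\<dots> = (\<Sum>i<n. if i = v then \<Sum>j<n. P i j else 0)" by (intro sum.cong) auto
    also have "\<dots> = (\<Sum>j<n. P v j)" using v by simp
    finally have "(\<Sum>e\<in>{e\<in>{..<m}. T e = v}. p e) = (\<Sum>j<n. P v j)" .
    moreover have "(\<Sum>e\<in>{e\<in>{..<m}. H e = v}. p e) = (\<Sum>i<n. P i v)"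
    proof -
      have "(\<Sum>e\<in>{e\<in>{..<m}. H e = v}. p e) = (\<Sum>k<m. if H k = v then p k else 0)"
        by (rule sum.inter_filter) simp
      also have "\<dots> = (\<Sum>k<m. p k * of_bool (H k = v))" by (intro sum.cong) auto
      also have "\<dots> = (\<Sum>i<n. \<Sum>j<n. P i j * of_bool (j = v))" by (rule flow[symmetric])
      also have "\<dots> = (\<Sum>i<n. \<Sum>j<n. if j = v then P i j else 0)" by (intro sum.cong) auto
      also have "\<dots> = (\<Sum>i<n. P i v)" using v by simp
      finally show ?thesis .
    qed
    ultimately show "\<bar>(\<Sum>e\<in>{e\<in>{..<m}. T e = v}. p e) - (\<Sum>e\<in>{e\<in>{..<m}. H e = v}. p e)\<bar> =
        \<bar>(\<Sum>j<n. P v j) - (\<Sum>j<n. P j v)\<bar>" by simp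
  qed
  obtain t s' st lam a b where res: "exec approx_min_mean_cycle s t s'" "t \<le> 200 * m * B"
    "idx.light_cycle st lam a b" "lam \<le> flow_cost G P w + \<epsilon> / 4 + 2 * real d * wmax * imbalance G P"
    "output_cycle s' = map (\<lambda>j. (T (st j), H (st j))) [a..<b]"
    using idx.wp_approx_min_mean_cycle[OF inp p_nonneg p_sum B] unfolding cost imb wp_def by auto
  have cyc: "pre_digraph.cycle (with_proj G) (output_cycle s')"
    unfolding res(5)
  proof (rule cycleI)
    show "(T (st j), H (st j)) \<in> parcs G" if "a \<le> j" "j < b" for j
      using TH(2)[of "st j"] res(3) that unfolding idx.light_cycle_def by simp
  qed (use res(3) in \<open>simp_all add: idx.light_cycle_def\<close>)
  have "a < b" and light: "(\<Sum>j=a..<b. real_mem s ''w'' (st j)) \<le> lam * (real b - real a)"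
    and st: "\<And>j. a \<le> j \<Longrightarrow> j < b \<Longrightarrow> st j < m"
    using res(3) by (auto simp: idx.light_cycle_def)
  have "mean_weight w (output_cycle s') = (\<Sum>j=a..<b. w (T (st j), H (st j))) / (real b - real a)"
    using \<open>a < b\<close> unfolding res(5) mean_weight_def
    by (simp add: comp_def sum_list_distinct_conv_sum_set of_nat_diff)
  also have "(\<Sum>j=a..<b. w (T (st j), H (st j))) = (\<Sum>j=a..<b. real_mem s ''w'' (st j))"
    using st TH(3) by (intro sum.cong) auto
  also have "\<dots> / (real b - real a) \<le> lam" using light \<open>a < b\<close> by (simp add: divide_le_eq)
  finally show "\<exists>t s'. exec approx_min_mean_cycle s t s' \<and> t \<le> 200 * card (parcs G) * B \<and>
    pre_digraph.cycle (with_proj G) (output_cycle s') \<and>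
    mean_weight w (output_cycle s') \<le>
      flow_cost G P w + \<epsilon> / 4 + 2 * real d * wmax * imbalance G P"
    using res(1,2,4) cyc unfolding m by (intro exI[of _ t] exI[of _ s']) auto
qed

theorem theorem4p1:
  shows "\<exists>(alg :: com) (C :: real).
    \<forall>(n :: nat) (G :: nat pair_pre_digraph) (es :: (nat \<times> nat) list)
      (w :: nat \<times> nat \<Rightarrow> real) (wmax :: real) (P :: nat \<Rightarrow> nat \<Rightarrow> real) (\<epsilon> :: real)
      (m :: nat) (d :: nat) (s :: state).
      pair_fin_digraph G \<and> pverts G = {..<n} \<and> strongly_connected (with_proj G) \<and>
      m = card (parcs G) \<and> d = diameter G \<and>
      (\<forall>e\<in>parcs G. w e \<in> {- wmax..wmax}) \<and>
      P \<in> normalized_flows G \<and> imbalance G P \<le> 1 / real d \<and> \<epsilon> > 0 \<and>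
      distinct es \<and> set es = parcs G \<and> input_loaded n es w P \<epsilon> s
      \<longrightarrow>
      (\<exists>(t :: nat) (s' :: state). exec alg s t s' \<and>
        (\<epsilon> \<le> real d * wmax \<longrightarrow> real t \<le> C * (real m * real d * wmax / \<epsilon>)) \<and>
        (\<epsilon> > real d * wmax \<longrightarrow> real t \<le> C * real m) \<and>
        (let \<sigma> = output_cycle s' in
          pre_digraph.cycle (with_proj G) \<sigma> \<and>
          mean_weight w \<sigma> \<le> flow_cost G P w + \<epsilon> / 4 + 4 * wmax * real d * imbalance G P \<and>
          (imbalance G P \<le> \<epsilon> / (16 * wmax * real d) \<longrightarrow>
            mean_weight w \<sigma> \<le> flow_cost G P w + \<epsilon> / 2)))"
proof (intro exI[of _ approx_min_mean_cycle] exI[of _ "2000 :: real"] allI impI, elim conjE)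
  fix n m d :: nat and G :: "nat pair_pre_digraph" and es :: "(nat \<times> nat) list"
    and w :: "nat \<times> nat \<Rightarrow> real" and wmax \<epsilon> :: real and P :: "nat \<Rightarrow> nat \<Rightarrow> real" and s :: state
  assume G: "pair_fin_digraph G" "pverts G = {..<n}" "strongly_connected (with_proj G)"
    and m: "m = card (parcs G)" and d: "d = diameter G"
    and w: "\<forall>e\<in>parcs G. w e \<in> {- wmax..wmax}" and P: "P \<in> normalized_flows G"
    and eps: "\<epsilon> > 0" and es: "distinct es" "set es = parcs G" and s: "input_loaded n es w P \<epsilon> s"
  define x where "x = real d * wmax / \<epsilon>"
  \<comment> \<open>Rounding up gives a natural bound on the rounds between \<open>8 * x + 1\<close>
    and \<open>8 * x + 2\<close>.\<close>
  define B where "B = nat \<lceil>8 * x\<rceil> + 1"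
  have B: "8 * real d * wmax / \<epsilon> + 1 \<le> real B" unfolding B_def x_def by simp linarith
  note main = approx_min_mean_cycle_correct[OF G d bspec[OF w] P eps es s B, folded m]
  have wmax: "0 \<le> wmax" by (rule main(1))
  have imb: "0 \<le> imbalance G P" unfolding imbalance_def by (intro sum_nonneg) simp
  obtain t s' where res: "exec approx_min_mean_cycle s t s'" "t \<le> 200 * m * B"
    "pre_digraph.cycle (with_proj G) (output_cycle s')"
    "mean_weight w (output_cycle s') \<le> flow_cost G P w + \<epsilon> / 4 + 2 * real d * wmax * imbalance G P"
    using main(2) by blast
  have x0: "0 \<le> x" unfolding x_def using wmax eps by simp
  then have Bx: "real B \<le> 8 * x + 2" unfolding B_def by simp linarith
  have "real t \<le> 200 * real m * real B"
    using of_nat_mono[OF res(2), where 'a = real] by simp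
  also have "\<dots> \<le> 200 * real m * (8 * x + 2)"
    by (rule mult_left_mono[OF Bx]) simp
  finally have t: "real t \<le> \<dots>" .
  have time1: "real t \<le> 2000 * (real m * real d * wmax / \<epsilon>)" if "\<epsilon> \<le> real d * wmax"
  proof -
    have "1 \<le> x" unfolding x_def using that eps by (simp add: le_divide_eq)
    \<comment> \<open>The additive 2 is absorbed by \<open>2 * x\<close>, which yields the constant
      \<open>200 * 10\<close>.\<close>
    then have "200 * real m * (8 * x + 2) \<le> 200 * real m * (10 * x)" by (intro mult_left_mono) auto
    then show ?thesis using t by (simp add: x_def)
  qed
  have time2: "real t \<le> 2000 * real m" if "\<epsilon> > real d * wmax"
  proof -
    have "x \<le> 1" unfolding x_def using that eps by (simp add: divide_le_eq)
    then have "200 * real m * (8 * x + 2) \<le> 200 * real m * 10" by (intro mult_left_mono) auto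
    then show ?thesis using t by simp
  qed
  have le: "mean_weight w (output_cycle s') \<le> flow_cost G P w + \<epsilon> / 4 + 4 * wmax * real d * imbalance G P"
  proof -
    \<comment> \<open>The bound proved has the factor 2; nonnegativity of the imbalance term relaxes
      it to 4.\<close>
    have "0 \<le> real d * wmax * imbalance G P" using wmax imb by simp
    then show ?thesis using res(4) by (simp add: mult_ac)
  qed
  have imb_le: "4 * wmax * real d * imbalance G P \<le> \<epsilon> / 4" if "imbalance G P \<le> \<epsilon> / (16 * wmax * real d)"
  \<comment> \<open>Division by 0 yields 0, so the case \<open>wmax * real d = 0\<close> is
    separate; there the left-hand side vanishes.\<close>
  proof (cases "wmax * real d = 0")
    case False
    then have "0 < wmax * real d" using wmax by (intro order.not_eq_order_implies_strict) auto
    then have "imbalance G P * (16 * wmax * real d) \<le> \<epsilon>"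
      using that by (subst (asm) pos_le_divide_eq) simp_all
    then show ?thesis by (simp add: algebra_simps)
  next
    case True
    then have "4 * wmax * real d * imbalance G P = 0" by simp
    then show ?thesis using eps by linarith
  qed
  have le2: "mean_weight w (output_cycle s') \<le> flow_cost G P w + \<epsilon> / 2"
    if "imbalance G P \<le> \<epsilon> / (16 * wmax * real d)"
    using le imb_le[OF that] by linarith
  show "\<exists>t s'. exec approx_min_mean_cycle s t s' \<and>
        (\<epsilon> \<le> real d * wmax \<longrightarrow> real t \<le> 2000 * (real m * real d * wmax / \<epsilon>)) \<and>
        (\<epsilon> > real d * wmax \<longrightarrow> real t \<le> 2000 * real m) \<and>
        (let \<sigma> = output_cycle s' in
          pre_digraph.cycle (with_proj G) \<sigma> \<and>
          mean_weight w \<sigma> \<le> flow_cost G P w + \<epsilon> / 4 + 4 * wmax * real d * imbalance G P \<and>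
          (imbalance G P \<le> \<epsilon> / (16 * wmax * real d) \<longrightarrow>
            mean_weight w \<sigma> \<le> flow_cost G P w + \<epsilon> / 2))"
    unfolding Let_def
    by (intro exI[of _ t] exI[of _ s'] conjI impI res(1,3) time1 time2 le le2)
qed

end
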